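(* Let $p\ge3$ be an integer and let $\ell\in\mathbb R$, $\ell\neq K^{(p)}(\beta_c)$, and assume that $(K^{(p)}(\beta_c)-\ell)(-1)^p<0$. For $\alpha>0$ define $$\beta_n=\beta_c-\frac1{n^\alpha},\qquad K_n=K(\beta_c)+\sum_{j=1}^{p-1}\frac{K^{(j)}(\beta_c)(-1)^j}{j!\,n^{j\alpha}}+\frac{\ell(-1)^p}{p!\,n^{p\alpha}} .$$ Let $$g(x)=\frac1{p!}\beta_c\bigl(K^{(p)}(\beta_c)-\ell\bigr)(-1)^px^2+4c_4x^4,\qquad c_4=3/16,$$ let $\bar x>0$ be the unique positive global minimum point of $g$, and let $$\bar z=\frac{\int_{\mathbb R}|x|\exp[-g(x)]\,dx}{\int_{\mathbb R}\exp[-g(x)]\,dx}.$$ Then: (a) For all $\alpha>0$, $m(\beta_n,K_n)\sim\bar x/n^{(p-1)\alpha/2}=\bar x(\beta_c-\beta_n)^{(p-1)/2}$. (b) For all $0<\alpha<\alpha_0=1/(2p-1)$, $E_{n,\beta_n,K_n}\{|S_n/n|\}\sim\bar x/n^{(p-1)\alpha/2}\sim m(\beta_n,K_n)$. (c) For $\alpha=\alpha_0=1/(2p-1)$, $E_{n,\beta_n,K_n}\{|S_n/n|\}\sim\bar z/n^{(p-1)/[2(2p-1)]}\sim\bar z\cdot m(\beta_n,K_n)/\bar x$.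
   Context: Mean-field Blume--Capel model. Let $\Lambda=\{1,0,-1\}$. For $n\in\mathbb N$, $K>0$ and $\omega=(\omega_1,\dots,\omega_n)\in\Lambda^n$ put $S_n(\omega)=\sum_{j=1}^n\omega_j$ and $H_{n,K}(\omega)=\sum_{j=1}^n\omega_j^2-\frac Kn\bigl(\sum_{j=1}^n\omega_j\bigr)^2$. For $\beta>0$, $P_{n,\beta,K}$ is the probability measure on $\Lambda^n$ giving $\omega$ probability proportional to $\exp[-\beta H_{n,K}(\omega)]$; $E_{n,\beta,K}$ denotes expectation with respect to $P_{n,\beta,K}$. Free-energy functional: $c_\beta(t)=\log\frac{1+e^{-\beta}(e^t+e^{-t})}{1+2e^{-\beta}}$ and $G_{\beta,K}(x)=\beta Kx^2-c_\beta(2\beta Kx)$ for $x\in\mathbb R$. $\mathcal M_{\beta,K}$ is the set of global minimum points of $G_{\beta,K}$. Let $\beta_c=\log4$ and $K(\beta)=(e^\beta+2)/(4\beta)$ for $\beta>0$; $K^{(j)}$ is the $j$th derivative of this function. The phase-coexistence region is the set of $(\beta,K)$, $\beta,K>0$, for which $\mathcal M_{\beta,K}$ has more than one element. It is known that for such $(\beta,K)$, $\mathcal M_{\beta,K}$ is $\{\pm m(\beta,K)\}$ or $\{0,\pm m(\beta,K)\}$ with $m(\beta,K)>0$; this unique positive global minimum point $m(\beta,K)$ is the thermodynamic magnetization. Notation: $a_n\sim b_n$ means $a_n/b_n\to1$ as $n\to\infty$. All quantities are considered for $n$ large enough that $\beta_n,K_n>0$ and $(\beta_n,K_n)$ lies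 in the phase-coexistence region (which holds for all sufficiently large $n$ under the stated assumptions). *)

theory Defs
  imports "HOL-Probability.Probability" "HOL-Library.Landau_Symbols"
begin

section \<open>The mean-field Blume--Capel model\<close>

definition spins :: "real set" where
  "spins = {1, 0, -1}"

definition configs :: "nat \<Rightarrow> (nat \<Rightarrow> real) set" where
  "configs n = PiE {1..n} (\<lambda>_. spins)"

definition total_spin :: "nat \<Rightarrow> (nat \<Rightarrow> real) \<Rightarrow> real" where
  "total_spin n \<omega> = (\<Sum>j=1..n. \<omega> j)"

definition hamiltonian :: "nat \<Rightarrow> real \<Rightarrow> (nat \<Rightarrow> real) \<Rightarrow> real" where
  "hamiltonian n K \<omega> = (\<Sum>j=1..n. (\<omega> j)\<^sup>2) - K / real n * (\<Sum>j=1..n. \<omega> j)\<^sup>2"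

definition partition_fun :: "nat \<Rightarrow> real \<Rightarrow> real \<Rightarrow> real" where
  "partition_fun n \<beta> K = (\<Sum>\<omega>\<in>configs n. exp (- \<beta> * hamiltonian n K \<omega>))"

definition blume_capel :: "nat \<Rightarrow> real \<Rightarrow> real \<Rightarrow> (nat \<Rightarrow> real) measure" where
  "blume_capel n \<beta> K =
     point_measure (configs n)
       (\<lambda>\<omega>. ennreal (exp (- \<beta> * hamiltonian n K \<omega>) / partition_fun n \<beta> K))"

definition mean_abs_spin :: "nat \<Rightarrow> real \<Rightarrow> real \<Rightarrow> real" where
  "mean_abs_spin n \<beta> K = (\<integral>\<omega>. \<bar>total_spin n \<omega> / real n\<bar> \<partial>blume_capel n \<beta> K)"

lemma prob_space_blume_capel: "prob_space (blume_capel n \<beta> K)"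
proof
  have fin: "finite (configs n)"
    by (simp add: configs_def spins_def finite_PiE)
  have "configs n \<noteq> {}"
    by (simp add: configs_def spins_def PiE_eq_empty_iff)
  then have pos: "partition_fun n \<beta> K > 0"
    unfolding partition_fun_def using fin by (intro sum_pos) auto
  have "emeasure (blume_capel n \<beta> K) (configs n)
      = (\<Sum>\<omega>\<in>configs n. ennreal (exp (- \<beta> * hamiltonian n K \<omega>) / partition_fun n \<beta> K))"
    unfolding blume_capel_def using fin by (simp add: emeasure_point_measure_finite)
  also have "\<dots> = ennreal (\<Sum>\<omega>\<in>configs n. exp (- \<beta> * hamiltonian n K \<omega>) / partition_fun n \<beta> K)"
    using pos by (intro sum_ennreal) simp
  also have "(\<Sum>\<omega>\<in>configs n. exp (- \<beta> * hamiltonian n K \<omega>) / partition_fun n \<beta> K) = 1"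
    using pos by (simp flip: sum_divide_distrib add: partition_fun_def)
  finally show "emeasure (blume_capel n \<beta> K) (space (blume_capel n \<beta> K)) = 1"
    by (simp add: blume_capel_def space_point_measure)
qed


section \<open>Free-energy functional and thermodynamic magnetization\<close>

definition cumulant :: "real \<Rightarrow> real \<Rightarrow> real" where
  "cumulant \<beta> t = ln ((1 + exp (- \<beta>) * (exp t + exp (- t))) / (1 + 2 * exp (- \<beta>)))"

definition free_energy :: "real \<Rightarrow> real \<Rightarrow> real \<Rightarrow> real" where
  "free_energy \<beta> K x = \<beta> * K * x\<^sup>2 - cumulant \<beta> (2 * \<beta> * K * x)"

definition global_min_points :: "(real \<Rightarrow> real) \<Rightarrow> real set" where
  "global_min_points f = {x. \<forall>y. f x \<le> f y}"

text \<open>Meaningful only when \<open>f\<close> has exactly one positive global minimum point.\<close>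

definition pos_min_point :: "(real \<Rightarrow> real) \<Rightarrow> real" where
  "pos_min_point f = (THE x. 0 < x \<and> x \<in> global_min_points f)"

definition coexistence_region :: "(real \<times> real) set" where
  "coexistence_region =
     {(\<beta>, K). 0 < \<beta> \<and> 0 < K \<and>
       (\<exists>x\<in>global_min_points (free_energy \<beta> K). \<exists>y\<in>global_min_points (free_energy \<beta> K). x \<noteq> y)}"

text \<open>Positive global minimum points exist exactly in the phase-coexistence region, so the
  definition of \<open>magnetization\<close> below is meaningful only there.\<close>

lemma coexistence_region_iff:
  assumes "0 < \<beta>" "0 < K"
  shows "(\<beta>, K) \<in> coexistence_region \<longleftrightarrow>
    (\<exists>x>0. x \<in> global_min_points (free_energy \<beta> K))"
proof -
  let ?M = "global_min_points (free_energy \<beta> K)"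
  have "free_energy \<beta> K (- x) = free_energy \<beta> K x" for x
    by (simp add: free_energy_def cumulant_def add.commute)
  then have even: "- x \<in> ?M" if "x \<in> ?M" for x
    using that by (simp add: global_min_points_def)
  show ?thesis
  proof
    assume "(\<beta>, K) \<in> coexistence_region"
    then obtain x y where "x \<in> ?M" "y \<in> ?M" "x \<noteq> y"
      by (auto simp: coexistence_region_def)
    then obtain z where "z \<in> ?M" "z \<noteq> 0" by metis
    then show "\<exists>x>0. x \<in> ?M"
      using even[of z] by (metis neg_0_less_iff_less linorder_neqE_linordered_idom)
  next
    assume "\<exists>x>0. x \<in> ?M"
    then obtain x where "x > 0" "x \<in> ?M" by blast
    then have "- x \<in> ?M" "x \<noteq> - x" using even by auto
    with \<open>x \<in> ?M\<close> assms show "(\<beta>, K) \<in> coexistence_region"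
      unfolding coexistence_region_def by blast
  qed
qed

definition magnetization :: "real \<Rightarrow> real \<Rightarrow> real" where
  "magnetization \<beta> K = pos_min_point (free_energy \<beta> K)"


section \<open>The sequences approaching the tricritical point\<close>

definition beta_c :: real where
  "beta_c = ln 4"

definition K_curve :: "real \<Rightarrow> real" where
  "K_curve \<beta> = (exp \<beta> + 2) / (4 * \<beta>)"

abbreviation K_deriv :: "nat \<Rightarrow> real" where
  "K_deriv j \<equiv> (deriv ^^ j) K_curve beta_c"

definition beta_seq :: "real \<Rightarrow> nat \<Rightarrow> real" where
  "beta_seq \<alpha> n = beta_c - 1 / real n powr \<alpha>"

definition K_seq :: "nat \<Rightarrow> real \<Rightarrow> real \<Rightarrow> nat \<Rightarrow> real" where
  "K_seq p l \<alpha> n =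
     K_curve beta_c
     + (\<Sum>j=1..p-1. K_deriv j * (-1) ^ j / (fact j * real n powr (real j * \<alpha>)))
     + l * (-1) ^ p / (fact p * real n powr (real p * \<alpha>))"


section \<open>The Ginzburg--Landau polynomial\<close>

definition c4 :: real where
  "c4 = 3 / 16"

definition gl_poly :: "nat \<Rightarrow> real \<Rightarrow> real \<Rightarrow> real" where
  "gl_poly p l x =
     1 / fact p * beta_c * (K_deriv p - l) * (-1) ^ p * x\<^sup>2 + 4 * c4 * x ^ 4"

definition x_bar :: "nat \<Rightarrow> real \<Rightarrow> real" where
  "x_bar p l = pos_min_point (gl_poly p l)"

definition z_bar :: "nat \<Rightarrow> real \<Rightarrow> real" where
  "z_bar p l =
     (\<integral>x. \<bar>x\<bar> * exp (- gl_poly p l x) \<partial>lborel) / (\<integral>x. exp (- gl_poly p l x) \<partial>lborel)"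

end

theory Submission
  imports Defs
begin

text \<open>
Put \<open>r = 2 / (exp \<beta> + 2)\<close> and \<open>t = 2 \<beta> K x\<close>. The free-energy functional is then
\<open>\<beta> K x\<^sup>2 - ln (1 + r (cosh t - 1))\<close>, and its Taylor polynomial of order four at \<open>x = 0\<close> is
\<open>2 \<beta>\<^sup>2 K r (K_curve \<beta> - K) x\<^sup>2 + r (3 r - 1) t ^ 4 / 24\<close>. At the tricritical point
\<open>r = 1 / 3\<close>, \<open>t = 3 x\<close>, and both coefficients vanish. Along the given path the gap
\<open>K_curve \<beta>\<^sub>n - K\<^sub>n\<close> is of order \<open>n powr (- p \<alpha>)\<close>, because \<open>K\<^sub>n\<close> copies the Taylor
polynomial of the curve up to order \<open>p - 1\<close>, while \<open>r - 1 / 3\<close> is of order \<open>n powr (- \<alpha>)\<close>. The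
quadratic term (negative, by the sign hypothesis) and the quartic term balance at
\<open>x = y / scale n\<close> with \<open>scale n = n powr ((p - 1) \<alpha> / 2)\<close>, where both are of order
\<open>n powr (- (2 p - 1) \<alpha>)\<close>. The sextic remainder is smaller by the factor
\<open>n powr (- (p - 2) \<alpha>)\<close>. Hence the functional \<open>scaled_energy n y\<close>, which is
\<open>n powr ((2 p - 1) \<alpha>)\<close> times the free energy at \<open>y / scale n\<close>, tends to the
Ginzburg--Landau polynomial uniformly on compact sets (\<open>scaled_energy_uniform_limit\<close>).

Compact convergence says nothing about large \<open>y\<close>, and it controls neither global minimum points nor
integrals by itself. What closes this gap is an upper bound for the cumulant that holds for all \<open>t\<close>
and still has the exact term of order two and, to leading order as \<open>r\<close> tends to \<open>1 / 3\<close>, the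
correct term of order four (\<open>cumulant_upper\<close>). It yields the coercivity
\<open>y\<^sup>2 - C \<le> scaled_energy n y\<close> for all large \<open>n\<close> and all real \<open>y\<close>, with one constant
\<open>C\<close> (\<open>scaled_energy_coercive\<close>).

These two properties give everything. Positive global minimum points of the scaled energies
converge to that of the limit (\<open>minimizers_converge\<close>), which gives the asymptotics of the
magnetization; that there is only one positive minimum point follows from Rolle's theorem and a
concavity property valid for \<open>\<beta> \<le> beta_c\<close> (\<open>pos_global_min_unique\<close>). For the spin, adding to
\<open>S / n\<close> an independent centred Gaussian variable of variance \<open>1 / (2 n \<beta> K)\<close> produces the
density proportional to \<open>exp (- n free_energy)\<close>, so that the expectation of \<open>\<bar>S / n\<bar>\<close> differs
from the mean of \<open>\<bar>x\<bar>\<close> under that density by \<open>O(1 / sqrt n)\<close>, which is negligible against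
\<open>1 / scale n\<close> (\<open>mean_abs_spin_smoothed\<close>, \<open>smoothing_negligible\<close>). In the variable \<open>y\<close> the density
is \<open>exp (- N scaled_energy)\<close> with \<open>N = n powr (1 - (2 p - 1) \<alpha>)\<close>. If
\<open>\<alpha> < 1 / (2 p - 1)\<close> then \<open>N\<close> tends to infinity and the density concentrates at the two minimum
points (\<open>gibbs_abs_mean_concentrates\<close>); if \<open>\<alpha> = 1 / (2 p - 1)\<close> then \<open>N = 1\<close> and dominated
convergence gives the mean under \<open>exp (- gl_poly)\<close> (\<open>gibbs_abs_mean_converges\<close>).
\<close>

section \<open>The logarithmic moment generating function of a single spin\<close>

lemma cosh_minus_one_sums:
  fixes t :: real
  shows "(\<lambda>k. t ^ (2 * k + 2) / fact (2 * k + 2)) sums (cosh t - 1)"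
proof -
  have "strict_mono (\<lambda>k::nat. 2 * k)" by (simp add: strict_mono_def)
  moreover have "(if even n then t ^ n /\<^sub>R fact n else 0) = 0" if "n \<notin> range (\<lambda>k::nat. 2 * k)" for n
    using that by (auto elim!: evenE)
  ultimately have "(\<lambda>k. if even (2 * k) then t ^ (2 * k) /\<^sub>R fact (2 * k) else 0) sums cosh t"
    using sums_mono_reindex[of "\<lambda>k. 2 * k" "\<lambda>n. if even n then t ^ n /\<^sub>R fact n else 0" "cosh t"]
      cosh_converges[of t] by blast
  then have "(\<lambda>k. t ^ (2 * k) / fact (2 * k)) sums (cosh t)"
    by (simp add: scaleR_conv_of_real field_simps)
  then have "(\<lambda>k. t ^ (2 * Suc k) / fact (2 * Suc k)) sums (cosh t - 1)"
    by (subst sums_Suc_iff) simp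
  then show ?thesis by simp
qed

lemma cosh_lower:
  fixes t :: real
  shows "t\<^sup>2 / 2 + t ^ 4 / 24 \<le> cosh t - 1"
proof -
  have "(\<Sum>k<2. t ^ (2 * k + 2) / fact (2 * k + 2)) \<le> (\<Sum>k. t ^ (2 * k + 2) / fact (2 * k + 2))"
    by (intro sum_le_suminf sums_summable[OF cosh_minus_one_sums] divide_nonneg_nonneg
        zero_le_even_power fact_ge_zero) auto
  also have "\<dots> = cosh t - 1"
    using sums_unique[OF cosh_minus_one_sums[of t]] by simp
  finally show ?thesis
    by (simp add: numeral_2_eq_2 fact_numeral) (simp add: eval_nat_numeral)
qed

lemma six_power_fact_le: "6 ^ (k + 1) * fact (k + 1) \<le> (3 * fact (2 * k + 2) :: real)"
proof (induction k)
  case 0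
  then show ?case by (simp add: fact_numeral)
next
  case (Suc k)
  have "(6::real) * (real k + 2) \<le> (2 * real k + 4) * (2 * real k + 3)"
    by (simp add: algebra_simps)
  with Suc have "(6 * (real k + 2)) * (6 ^ (k + 1) * fact (k + 1))
      \<le> ((2 * real k + 4) * (2 * real k + 3)) * (3 * fact (2 * k + 2) :: real)"
    by (intro mult_mono[OF \<open>6 * (real k + 2) \<le> _\<close>]) (simp_all del: fact_Suc)
  also have "(6 * (real k + 2)) * (6 ^ (k + 1) * fact (k + 1)) = (6 ^ (Suc k + 1) * fact (Suc k + 1) :: real)"
    by simp
  also have "((2 * real k + 4) * (2 * real k + 3)) * (3 * fact (2 * k + 2)) = (3 * fact (2 * Suc k + 2) :: real)"
    by (simp add: algebra_simps)
  finally show ?case .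
qed

text \<open>Power series are compared term by term. In terms of the model, the cumulant at
  \<open>\<beta> = beta_c\<close> is at most \<open>t\<^sup>2 / 6\<close>. The two sides agree up to order four, which is the
  degeneracy of the tricritical point.\<close>

lemma cosh_le_gaussian:
  fixes t :: real
  shows "cosh t - 1 \<le> 3 * (exp (t\<^sup>2 / 6) - 1)"
proof -
  have "(\<lambda>k. (t\<^sup>2 / 6) ^ k / fact k) sums exp (t\<^sup>2 / 6)"
    using exp_converges[of "t\<^sup>2 / 6"] by (simp add: scaleR_conv_of_real field_simps)
  then have "(\<lambda>k. (t\<^sup>2 / 6) ^ Suc k / fact (Suc k)) sums (exp (t\<^sup>2 / 6) - 1)"
    by (subst sums_Suc_iff) simp
  then have s: "(\<lambda>k. 3 * ((t\<^sup>2 / 6) ^ Suc k / fact (Suc k))) sums (3 * (exp (t\<^sup>2 / 6) - 1))"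
    by (rule sums_mult)
  have "t ^ (2 * k + 2) / fact (2 * k + 2) \<le> 3 * ((t\<^sup>2 / 6) ^ Suc k / fact (Suc k))" for k
  proof -
    have "t ^ (2 * k + 2) / fact (2 * k + 2) = t ^ (2 * k + 2) * (1 / fact (2 * k + 2))"
      by simp
    also have "\<dots> \<le> t ^ (2 * k + 2) * (3 / (6 ^ (k + 1) * fact (k + 1)))"
    proof (intro mult_left_mono)
      show "1 / fact (2 * k + 2) \<le> (3 / (6 ^ (k + 1) * fact (k + 1)) :: real)"
        using six_power_fact_le[of k] by (simp only: frac_le_eq divide_le_eq) (simp del: fact_Suc add: divide_simps)
    qed (rule zero_le_even_power, simp)
    also have "\<dots> = 3 * ((t\<^sup>2 / 6) ^ Suc k / fact (Suc k))"
    proof -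
      have "t ^ (2 * k + 2) = (t\<^sup>2) ^ Suc k" by (simp only: power_mult[symmetric]) simp
      then show ?thesis by (simp only: power_divide Suc_eq_plus1) (simp del: fact_Suc power_Suc power_add power_Suc2)
    qed
    finally show ?thesis .
  qed
  from sums_le[OF this cosh_minus_one_sums s] show ?thesis .
qed

text \<open>Again term by term, with equality up to order four. For \<open>t\<^sup>2 < 12\<close> it bounds \<open>cosh t - 1\<close>
  itself. Its use for all \<open>t\<close> is the equivalent form
  \<open>3 C / (3 + C) \<le> 6 t\<^sup>2 / (12 + t\<^sup>2)\<close> with \<open>C = cosh t - 1\<close>.\<close>

lemma cosh_rational_upper:
  fixes t :: real
  shows "(cosh t - 1) * (12 - t\<^sup>2) \<le> 6 * t\<^sup>2"
proof -
  have "(\<lambda>k. t ^ (2 * Suc k + 2) / fact (2 * Suc k + 2)) sums (cosh t - 1 - t\<^sup>2 / 2)"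
    using cosh_minus_one_sums[of t] by (subst sums_Suc_iff) (simp add: numeral_2_eq_2)
  from sums_mult[OF this, of 12]
  have 1: "(\<lambda>k. 12 * (t ^ (2 * Suc k + 2) / fact (2 * Suc k + 2))) sums (12 * (cosh t - 1 - t\<^sup>2 / 2))" .
  have 2: "(\<lambda>k. t\<^sup>2 * (t ^ (2 * k + 2) / fact (2 * k + 2))) sums (t\<^sup>2 * (cosh t - 1))"
    by (rule sums_mult[OF cosh_minus_one_sums])
  have "12 * (t ^ (2 * Suc k + 2) / fact (2 * Suc k + 2)) \<le> t\<^sup>2 * (t ^ (2 * k + 2) / fact (2 * k + 2))" for k
  proof -
    have f: "fact (2 * Suc k + 2) = (2 * real k + 4) * (2 * real k + 3) * fact (2 * k + 2)"
      by (simp add: algebra_simps)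
    have g: "12 \<le> (2 * real k + 4) * (2 * real k + 3)" by (simp add: algebra_simps)
    have "12 * (t ^ (2 * Suc k + 2) / fact (2 * Suc k + 2))
        = (t ^ (2 * k + 4) / fact (2 * k + 2)) * (12 / ((2 * real k + 4) * (2 * real k + 3)))"
      unfolding f by (simp del: fact_Suc add: add_ac eval_nat_numeral mult_ac)
    also have "\<dots> \<le> (t ^ (2 * k + 4) / fact (2 * k + 2)) * 1"
      using g by (intro mult_left_mono divide_nonneg_nonneg zero_le_even_power) (auto simp: divide_le_eq)
    also have "\<dots> = t\<^sup>2 * (t ^ (2 * k + 2) / fact (2 * k + 2))"
      by (simp add: eval_nat_numeral)
    finally show ?thesis .
  qed
  from sums_le[OF this 1 2] show ?thesis by (simp add: algebra_simps)
qed

lemma cosh_upper: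
  fixes t :: real
  assumes "\<bar>t\<bar> \<le> 1"
  shows "cosh t - 1 \<le> t\<^sup>2 / 2 + t ^ 4 / 12"
proof -
  have t: "t\<^sup>2 \<le> 1" using assms by (simp add: abs_square_le_1)
  have "6 * t\<^sup>2 \<le> (t\<^sup>2 / 2 + t ^ 4 / 12) * (12 - t\<^sup>2)"
  proof -
    have "(t\<^sup>2 / 2 + t ^ 4 / 12) * (12 - t\<^sup>2) = 6 * t\<^sup>2 + t^4 * (1/2 - t\<^sup>2 / 12)"
      by (simp add: field_simps eval_nat_numeral)
    moreover have "0 \<le> t^4 * (1/2 - t\<^sup>2 / 12)" using t by (intro mult_nonneg_nonneg) auto
    ultimately show ?thesis by linarith
  qed
  with cosh_rational_upper[of t]
  have "(cosh t - 1) * (12 - t\<^sup>2) \<le> (t\<^sup>2 / 2 + t ^ 4 / 12) * (12 - t\<^sup>2)" by linarith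
  then show ?thesis using t by simp
qed

lemma ln_one_plus_ge_quadratic:
  fixes u :: real
  assumes "0 \<le> u"
  shows "u - u\<^sup>2 / 2 \<le> ln (1 + u)"
proof -
  have "(\<lambda>u. ln (1 + u) - u + u\<^sup>2 / 2) 0 \<le> (\<lambda>u. ln (1 + u) - u + u\<^sup>2 / 2) u"
  proof (rule DERIV_nonneg_imp_nondecreasing[OF assms])
    fix x :: real assume "0 \<le> x" "x \<le> u"
    then have "((\<lambda>u. ln (1 + u) - u + u\<^sup>2 / 2) has_real_derivative (1 / (1 + x) - 1 + x)) (at x)"
      by (auto intro!: derivative_eq_intros)
    moreover have "1 / (1 + x) - 1 + x \<ge> 0"
      using \<open>0 \<le> x\<close> by (simp add: field_simps)
    ultimately show "\<exists>y. ((\<lambda>u. ln (1 + u) - u + u\<^sup>2 / 2) has_real_derivative y) (at x) \<and> y \<ge> 0"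
      by blast
  qed
  then show ?thesis by simp
qed

text \<open>The left side is concave in \<open>r\<close>, so it lies below its tangent at \<open>r = 1 / 3\<close>. There its value is at
  most \<open>t\<^sup>2 / 6\<close> by \<open>cosh_le_gaussian\<close> and its slope is bounded by \<open>cosh_rational_upper\<close>. The
  denominator \<open>12 + t\<^sup>2\<close> keeps the estimate valid for all \<open>t\<close> without changing
  the term of order four.\<close>

lemma cumulant_upper:
  fixes r t :: real
  assumes "1 / 3 \<le> r"
  shows "ln (1 + r * (cosh t - 1)) \<le> r * t\<^sup>2 / 2 - (r - 1 / 3) * (t ^ 4 / (2 * (12 + t\<^sup>2)))"
proof -
  define C where "C = cosh t - 1"
  have C0: "0 \<le> C" by (simp add: C_def cosh_real_ge_1)
  have r0: "0 \<le> r * C" using assms C0 by (intro mult_nonneg_nonneg) auto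
  \<comment> \<open>The estimate \<open>ln u \<le> u - 1\<close> for the quotient gives the tangent line at \<open>r = 1 / 3\<close>.\<close>
  have "ln (1 + r * C) = ln (1 + C / 3) + ln ((1 + r * C) / (1 + C / 3))"
    using C0 r0 by (subst ln_div) auto
  also have "ln (1 + C / 3) \<le> ln (exp (t\<^sup>2 / 6))"
    using cosh_le_gaussian[of t] C0 unfolding C_def[symmetric]
    by (intro ln_mono) auto
  also have "ln (exp (t\<^sup>2 / 6)) = t\<^sup>2 / 6" by simp
  also have "ln ((1 + r * C) / (1 + C / 3)) \<le> (1 + r * C) / (1 + C / 3) - 1"
    using C0 r0 by (intro ln_le_minus_one divide_pos_pos) auto
  also have "(1 + r * C) / (1 + C / 3) - 1 = (r - 1 / 3) * (3 * C / (3 + C))"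
    using C0 by (simp add: field_simps)
  also have "\<dots> \<le> (r - 1 / 3) * (6 * t\<^sup>2 / (12 + t\<^sup>2))"
  proof -
    have "12 + t\<^sup>2 > 0" by (simp add: add_pos_nonneg)
    then have "3 * C / (3 + C) \<le> 6 * t\<^sup>2 / (12 + t\<^sup>2)"
      using cosh_rational_upper[of t] C0 unfolding C_def[symmetric]
      by (simp add: frac_le_eq divide_le_0_iff) (simp add: algebra_simps)
    then show ?thesis using assms by (intro mult_left_mono) auto
  qed
  also have "6 * t\<^sup>2 / (12 + t\<^sup>2) = t\<^sup>2 / 2 - t ^ 4 / (2 * (12 + t\<^sup>2))"
  proof -
    have "12 + t\<^sup>2 \<noteq> 0" by (metis add_pos_nonneg zero_le_power2 zero_less_numeral less_irrefl)
    then show ?thesis by (simp add: field_simps eval_nat_numeral)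
  qed
  finally have "ln (1 + r * C) \<le> t\<^sup>2 / 6 + (r - 1 / 3) * (t\<^sup>2 / 2 - t ^ 4 / (2 * (12 + t\<^sup>2)))" by simp
  also have "\<dots> = r * t\<^sup>2 / 2 - (r - 1 / 3) * (t ^ 4 / (2 * (12 + t\<^sup>2)))"
    by (simp only: right_diff_distrib left_diff_distrib)
  finally show ?thesis by (simp only: C_def)
qed

text \<open>Near the origin the correction to \<open>r t\<^sup>2 / 2\<close> in \<open>cumulant_upper\<close> is sharp to leading order as
  \<open>r\<close> tends to \<open>1 / 3\<close>. The remainder \<open>t ^ 6\<close> is uniform in \<open>r\<close>, as needed when \<open>r\<close> varies with
  \<open>n\<close>.\<close>

lemma cumulant_lower:
  fixes r t :: real
  assumes "0 \<le> r" "r \<le> 1" "\<bar>t\<bar> \<le> 1"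
  shows "r * t\<^sup>2 / 2 - r * (3 * r - 1) * t ^ 4 / 24 - t ^ 6 \<le> ln (1 + r * (cosh t - 1))"
proof -
  define C where "C = cosh t - 1"
  have C0: "0 \<le> C" by (simp add: C_def cosh_real_ge_1)
  have t: "t\<^sup>2 \<le> 1" using assms by (simp add: abs_square_le_1)
  have "C\<^sup>2 \<le> (t\<^sup>2 / 2 + t ^ 4 / 12)\<^sup>2"
    using cosh_upper[OF assms(3)] C0 unfolding C_def[symmetric] by (intro power_mono) auto
  also have "\<dots> = t ^ 4 / 4 + t ^ 6 * (1 / 12 + t\<^sup>2 / 144)"
    by (simp add: power2_eq_square algebra_simps eval_nat_numeral)
  also have "\<dots> \<le> t ^ 4 / 4 + t ^ 6 * 2"
    using t by (intro add_left_mono mult_left_mono) auto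
  finally have "C\<^sup>2 \<le> t ^ 4 / 4 + t ^ 6 * 2" .
  then have "r\<^sup>2 * C\<^sup>2 \<le> r\<^sup>2 * (t ^ 4 / 4 + t ^ 6 * 2)" by (intro mult_left_mono) auto
  moreover have "r\<^sup>2 * t ^ 6 \<le> 1 * t ^ 6"
    using assms by (intro mult_right_mono) (auto simp: power_le_one)
  moreover have "r * (t\<^sup>2 / 2 + t ^ 4 / 24) \<le> r * C"
    using cosh_lower[of t] assms unfolding C_def[symmetric] by (intro mult_left_mono) auto
  moreover have "r * C - (r * C)\<^sup>2 / 2 \<le> ln (1 + r * C)"
    using assms C0 by (intro ln_one_plus_ge_quadratic mult_nonneg_nonneg) auto
  moreover have "(r * C)\<^sup>2 = r\<^sup>2 * C\<^sup>2" "r * (t\<^sup>2 / 2 + t ^ 4 / 24) = r * t\<^sup>2 / 2 + r * t ^ 4 / 24"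
    "r\<^sup>2 * (t ^ 4 / 4 + t ^ 6 * 2) = r\<^sup>2 * t ^ 4 / 4 + 2 * (r\<^sup>2 * t ^ 6)"
    "r * (3 * r - 1) * t ^ 4 / 24 = r\<^sup>2 * t ^ 4 / 8 - r * t ^ 4 / 24"
    by (simp_all add: power_mult_distrib field_simps power2_eq_square)
  ultimately show ?thesis
    unfolding C_def[symmetric] by linarith
qed

section \<open>Gaussian integrals and coercive exponents\<close>

lemma gaussian_integrals:
  fixes a s :: real
  assumes a: "0 < a"
  shows gaussian_has_integral:
      "has_bochner_integral lborel (\<lambda>x. exp (- a * (x - s)\<^sup>2)) (sqrt (pi / a))"
    and gaussian_abs_has_integral:
      "has_bochner_integral lborel (\<lambda>x. \<bar>x - s\<bar> * exp (- a * (x - s)\<^sup>2)) (1 / a)"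
proof -
  define \<sigma> where "\<sigma> = sqrt (1 / (2 * a))"
  have \<sigma>: "0 < \<sigma>" "\<sigma>\<^sup>2 = 1 / (2 * a)" using a by (auto simp: \<sigma>_def)
  have dens: "sqrt (pi / a) * normal_density s \<sigma> x = exp (- a * (x - s)\<^sup>2)" for x
    using a by (simp add: normal_density_def \<sigma>(2) mult.commute)
  have "has_bochner_integral lborel (\<lambda>x. sqrt (pi / a) * (normal_density s \<sigma> x * (x - s) ^ (2 * 0)))
     (sqrt (pi / a) * (fact (2 * 0) / ((2 / \<sigma>\<^sup>2) ^ 0 * fact 0)))"
    by (intro has_bochner_integral_mult_right normal_moment_even \<sigma>(1))
  then show "has_bochner_integral lborel (\<lambda>x. exp (- a * (x - s)\<^sup>2)) (sqrt (pi / a))"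
    by (simp add: dens)
  have "has_bochner_integral lborel
     (\<lambda>x. sqrt (pi / a) * (normal_density s \<sigma> x * \<bar>x - s\<bar> ^ (2 * 0 + 1)))
     (sqrt (pi / a) * (2 ^ 0 * \<sigma> ^ (2 * 0 + 1) * fact 0 * sqrt (2 / pi)))"
    by (intro has_bochner_integral_mult_right normal_moment_abs_odd \<sigma>(1))
  moreover have "sqrt (pi / a) * (2 ^ 0 * \<sigma> ^ (2 * 0 + 1) * fact 0 * sqrt (2 / pi)) = 1 / a"
    using a by (simp add: \<sigma>_def flip: real_sqrt_mult) (simp add: real_sqrt_divide)
  moreover have "sqrt (pi / a) * (normal_density s \<sigma> x * \<bar>x - s\<bar> ^ (2 * 0 + 1))
      = \<bar>x - s\<bar> * exp (- a * (x - s)\<^sup>2)" for x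
    unfolding dens[symmetric] by simp
  ultimately show "has_bochner_integral lborel (\<lambda>x. \<bar>x - s\<bar> * exp (- a * (x - s)\<^sup>2)) (1 / a)"
    by (simp only:)
qed

lemma integrable_exp_coercive:
  fixes f :: "real \<Rightarrow> real"
  assumes [measurable]: "f \<in> borel_measurable borel" and "\<And>y. y\<^sup>2 - C \<le> f y"
  shows integrable_exp_minus: "integrable lborel (\<lambda>y. exp (- f y))"
    and integrable_abs_exp_minus: "integrable lborel (\<lambda>y. \<bar>y\<bar> * exp (- f y))"
proof -
  have le: "exp (- f y) \<le> exp C * exp (- 1 * (y - 0)\<^sup>2)" for y
    using assms(2)[of y] by (simp flip: exp_add)
  have "integrable lborel (\<lambda>y. exp C * exp (- 1 * (y - 0)\<^sup>2))"
    by (intro integrable_mult_right integrable.intros[OF gaussian_has_integral]) auto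
  then show "integrable lborel (\<lambda>y. exp (- f y))"
    by (rule Bochner_Integration.integrable_bound) (use le in auto)
  have "integrable lborel (\<lambda>y. exp C * (\<bar>y - 0\<bar> * exp (- 1 * (y - 0)\<^sup>2)))"
    by (intro integrable_mult_right integrable.intros[OF gaussian_abs_has_integral]) auto
  then show "integrable lborel (\<lambda>y. \<bar>y\<bar> * exp (- f y))"
  proof (rule Bochner_Integration.integrable_bound)
    show "AE y in lborel. norm (\<bar>y\<bar> * exp (- f y)) \<le> norm (exp C * (\<bar>y - 0\<bar> * exp (- 1 * (y - 0)\<^sup>2)))"
    proof (rule AE_I2)
      fix y :: real
      show "norm (\<bar>y\<bar> * exp (- f y)) \<le> norm (exp C * (\<bar>y - 0\<bar> * exp (- 1 * (y - 0)\<^sup>2)))"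
        using mult_left_mono[OF le[of y], of "\<bar>y\<bar>"] by (simp add: abs_mult mult_ac)
    qed
  qed simp
qed

text \<open>The point \<open>0\<close> is exempt because the lemma is also meant for \<open>\<bar>y\<bar> * exp (- g y)\<close>.\<close>

lemma integral_pos_off_zero:
  fixes f :: "real \<Rightarrow> real"
  assumes "integrable lborel f" "\<And>y. 0 \<le> f y" "\<And>y. y \<noteq> 0 \<Longrightarrow> 0 < f y"
  shows "0 < (\<integral>y. f y \<partial>lborel)"
proof -
  have "(\<integral>y. f y \<partial>lborel) \<noteq> 0"
  proof
    assume "(\<integral>y. f y \<partial>lborel) = 0"
    then have "AE y in lborel. f y = 0"
      using integral_nonneg_eq_0_iff_AE[OF assms(1)] assms(2) by simp
    moreover have "AE y in lborel. y \<noteq> (0::real)" by (rule AE_lborel_singleton)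
    ultimately have "AE y in (lborel :: real measure). False"
      by eventually_elim (use assms(3) in force)
    then show False
      by (simp add: AE_iff_null null_sets_def)
  qed
  moreover have "0 \<le> (\<integral>y. f y \<partial>lborel)" using assms(2) by (intro integral_nonneg_AE) auto
  ultimately show ?thesis by simp
qed

lemma integral_ge_on_interval:
  fixes f :: "real \<Rightarrow> real"
  assumes "integrable lborel f" "\<And>x. 0 \<le> f x" "\<And>x. a \<le> x \<Longrightarrow> x \<le> b \<Longrightarrow> c \<le> f x" "a \<le> b"
  shows "c * (b - a) \<le> (\<integral>x. f x \<partial>lborel)"
proof -
  have "(\<integral>x. c * indicator {a..b} x \<partial>lborel) \<le> (\<integral>x. f x \<partial>lborel)"
  proof (rule integral_mono)
    show "integrable lborel (\<lambda>x. c * indicator {a..b} x)"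
      by (intro integrable_mult_right integrable_real_indicator) (auto simp: emeasure_lborel_Icc_eq)
  qed (use assms in \<open>auto simp: indicator_def\<close>)
  then show ?thesis using assms(4) by simp
qed

section \<open>Concentration and convergence of Gibbs averages\<close>

text \<open>On a compact interval the gap of \<open>g\<close> is inherited through uniform convergence; outside a large
  enough interval coercivity alone keeps \<open>h n\<close> above the minimum of \<open>g\<close>. Since \<open>g\<close> may
  take its minimum at \<open>- x\<close> as well, distances are measured by \<open>\<bar>\<bar>y\<bar> - x\<bar>\<close>.\<close>

lemma far_from_minimum:
  fixes h :: "nat \<Rightarrow> real \<Rightarrow> real" and g :: "real \<Rightarrow> real"
  assumes coercive: "\<forall>\<^sub>F n in sequentially. \<forall>y. y\<^sup>2 - C \<le> h n y"
    and unif: "\<And>R. uniform_limit {-R..R} h g sequentially"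
    and sep: "\<And>\<epsilon>. 0 < \<epsilon> \<Longrightarrow> \<exists>\<eta>>0. \<forall>y. \<epsilon> \<le> \<bar>\<bar>y\<bar> - x\<bar> \<longrightarrow> g x + \<eta> \<le> g y"
    and "0 < \<epsilon>"
  shows "\<exists>\<eta>>0. \<forall>\<^sub>F n in sequentially. \<forall>y. \<epsilon> \<le> \<bar>\<bar>y\<bar> - x\<bar> \<longrightarrow> g x + \<eta> \<le> h n y"
proof -
  obtain \<eta> where \<eta>: "0 < \<eta>" "\<And>y. \<epsilon> \<le> \<bar>\<bar>y\<bar> - x\<bar> \<Longrightarrow> g x + \<eta> \<le> g y"
    using sep[OF \<open>0 < \<epsilon>\<close>] by blast
  \<comment> \<open>Beyond \<open>R\<close> the coercive bound alone exceeds \<open>g x + \<eta>\<close>, because \<open>R \<le> R\<^sup>2\<close>.\<close>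
  define R where "R = 1 + \<bar>C + g x + \<eta>\<bar>"
  have R: "C + g x + \<eta> \<le> R\<^sup>2"
  proof -
    have "R * 1 \<le> R * R" unfolding R_def by (intro mult_left_mono) auto
    then show ?thesis unfolding power2_eq_square using R_def by linarith
  qed
  have "\<forall>\<^sub>F n in sequentially. \<forall>y\<in>{-R..R}. dist (h n y) (g y) < \<eta> / 2"
    using uniform_limitD[OF unif[of R], of "\<eta> / 2"] \<eta>(1) by (simp only: half_gt_zero)
  with coercive have "\<forall>\<^sub>F n in sequentially. \<forall>y. \<epsilon> \<le> \<bar>\<bar>y\<bar> - x\<bar> \<longrightarrow> g x + \<eta> / 2 \<le> h n y"
  proof eventually_elim
    case (elim n)
    show ?case
    proof (intro allI impI)
      fix y :: real assume y: "\<epsilon> \<le> \<bar>\<bar>y\<bar> - x\<bar>"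
      show "g x + \<eta> / 2 \<le> h n y"
      proof (cases "\<bar>y\<bar> \<le> R")
        case True
        then have "dist (h n y) (g y) < \<eta> / 2" using elim(2)[rule_format, of y] by (simp add: abs_le_iff)
        then show ?thesis using \<eta>(2)[OF y] by (simp add: dist_real_def abs_if split: if_splits)
      next
        case False
        then have "R\<^sup>2 \<le> \<bar>y\<bar>\<^sup>2" unfolding R_def by (intro power_mono) auto
        then show ?thesis using elim(1)[rule_format, of y] R \<eta>(1) by simp
      qed
    qed
  qed
  then show ?thesis using \<eta>(1) by (intro exI[of _ "\<eta> / 2"]) auto
qed

lemma minimizers_converge:
  fixes h :: "nat \<Rightarrow> real \<Rightarrow> real" and g :: "real \<Rightarrow> real" and y :: "nat \<Rightarrow> real"
  assumes coercive: "\<forall>\<^sub>F n in sequentially. \<forall>y. y\<^sup>2 - C \<le> h n y"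
    and unif: "\<And>R. uniform_limit {-R..R} h g sequentially"
    and sep: "\<And>\<epsilon>. 0 < \<epsilon> \<Longrightarrow> \<exists>\<eta>>0. \<forall>y. \<epsilon> \<le> \<bar>\<bar>y\<bar> - x\<bar> \<longrightarrow> g x + \<eta> \<le> g y"
    and min: "\<forall>\<^sub>F n in sequentially. 0 \<le> y n \<and> h n (y n) \<le> h n x"
  shows "y \<longlonglongrightarrow> x"
proof (rule LIMSEQ_I)
  fix \<epsilon> :: real assume "0 < \<epsilon>"
  then obtain \<eta> where \<eta>: "0 < \<eta>"
    "\<forall>\<^sub>F n in sequentially. \<forall>y. \<epsilon> \<le> \<bar>\<bar>y\<bar> - x\<bar> \<longrightarrow> g x + \<eta> \<le> h n y"
    using far_from_minimum[OF coercive unif sep] by blast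
  have "(\<lambda>n. h n x) \<longlonglongrightarrow> g x"
    by (rule tendsto_uniform_limitI[OF unif[of "\<bar>x\<bar>"]]) auto
  then have "\<forall>\<^sub>F n in sequentially. h n x < g x + \<eta>"
    using \<eta>(1) by (intro order_tendstoD) auto
  with \<eta>(2) min have "\<forall>\<^sub>F n in sequentially. norm (y n - x) < \<epsilon>"
  proof eventually_elim
    case (elim n)
    then have "\<not> \<epsilon> \<le> \<bar>\<bar>y n\<bar> - x\<bar>" by (metis linorder_not_le order_trans)
    then show ?case using elim by simp
  qed
  then show "\<exists>n0. \<forall>n\<ge>n0. norm (y n - x) < \<epsilon>" by (simp add: eventually_sequentially)
qed

text \<open>Laplace's method. Away from the minimum points the density \<open>exp (- N h)\<close> is at most
  \<open>exp (- (N - 1) (g x + \<eta>))\<close> times a fixed integrable function; near \<open>x\<close> it is at least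
  \<open>exp (- N (g x + \<eta> / 2))\<close>. The ratio of the two decays like \<open>exp (- N \<eta> / 2)\<close>, so only the
  values \<open>\<bar>y\<bar>\<close> close to \<open>x\<close> contribute to the mean.\<close>

lemma gibbs_abs_mean_concentrates:
  fixes h :: "nat \<Rightarrow> real \<Rightarrow> real" and g :: "real \<Rightarrow> real" and N :: "nat \<Rightarrow> real"
  assumes coercive: "\<forall>\<^sub>F n in sequentially. \<forall>y. y\<^sup>2 - C \<le> h n y"
    and unif: "\<And>R. uniform_limit {-R..R} h g sequentially"
    and sep: "\<And>\<epsilon>. 0 < \<epsilon> \<Longrightarrow> \<exists>\<eta>>0. \<forall>y. \<epsilon> \<le> \<bar>\<bar>y\<bar> - x\<bar> \<longrightarrow> g x + \<eta> \<le> g y"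
    and meas [measurable]: "\<And>n. h n \<in> borel_measurable borel"
    and cont: "isCont g x"
    and N: "filterlim N at_top sequentially"
  shows "(\<lambda>n. (\<integral>y. \<bar>y\<bar> * exp (- (N n * h n y)) \<partial>lborel) / (\<integral>y. exp (- (N n * h n y)) \<partial>lborel)) \<longlonglongrightarrow> x"
proof (rule LIMSEQ_I)
  fix r :: real assume "0 < r"
  define \<epsilon> where "\<epsilon> = r / 2"
  have \<epsilon>: "0 < \<epsilon>" using \<open>0 < r\<close> by (simp add: \<epsilon>_def)
  obtain \<eta> where \<eta>: "0 < \<eta>"
    "\<forall>\<^sub>F n in sequentially. \<forall>y. \<epsilon> \<le> \<bar>\<bar>y\<bar> - x\<bar> \<longrightarrow> g x + \<eta> \<le> h n y"
    using far_from_minimum[OF coercive unif sep \<epsilon>] by blast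
  obtain w where w: "0 < w" "\<And>y. \<bar>y - x\<bar> \<le> w \<Longrightarrow> g y < g x + \<eta> / 4"
  proof -
    obtain d where "0 < d" "\<And>y. \<bar>y - x\<bar> < d \<Longrightarrow> \<bar>g y - g x\<bar> < \<eta> / 4"
      using cont \<eta>(1) unfolding continuous_at_eps_delta dist_real_def by (metis zero_less_divide_iff zero_less_numeral)
    then show ?thesis
      by (intro that[of "d / 2"]) (simp, smt (verit) field_sum_of_halves)
  qed
  define R where "R = \<bar>x\<bar> + w"
  have near: "\<forall>\<^sub>F n in sequentially. \<forall>y\<in>{-R..R}. dist (h n y) (g y) < \<eta> / 4"
    using uniform_limitD[OF unif[of R], of "\<eta> / 4"] \<eta>(1) by simp
  define Q where "Q = (\<integral>y. (\<bar>y\<bar> + \<bar>x\<bar>) * exp (- (y\<^sup>2 - C)) \<partial>lborel)"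
  have Q_int: "integrable lborel (\<lambda>y. (\<bar>y\<bar> + \<bar>x\<bar>) * exp (- (y\<^sup>2 - C)))"
    unfolding distrib_right
    by (intro Bochner_Integration.integrable_add integrable_mult_right integrable_exp_minus[where C = C]
        integrable_abs_exp_minus[where C = C]) auto
  have Q0: "0 \<le> Q" unfolding Q_def by (intro integral_nonneg_AE) auto
  have "(\<lambda>n. Q / (2 * w) * exp (g x + \<eta>) * exp (- (N n * (\<eta> / 2)))) \<longlonglongrightarrow> Q / (2 * w) * exp (g x + \<eta>) * 0"
  proof (intro tendsto_mult tendsto_const filterlim_compose[OF exp_at_bot])
    show "filterlim (\<lambda>n. - (N n * (\<eta> / 2))) at_bot sequentially"
      unfolding filterlim_uminus_at_top[symmetric]
      by (rule filterlim_at_top_mult_tendsto_pos[OF tendsto_const _ N]) (use \<eta>(1) in simp)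
  qed
  then have small: "\<forall>\<^sub>F n in sequentially. Q / (2 * w) * exp (g x + \<eta>) * exp (- (N n * (\<eta> / 2))) < \<epsilon>"
    using \<epsilon> by (intro order_tendstoD) auto
  have "\<forall>\<^sub>F n in sequentially. 1 \<le> N n" using N by (simp add: filterlim_at_top)
  with \<eta>(2) near coercive small
  have "\<forall>\<^sub>F n in sequentially. norm ((\<integral>y. \<bar>y\<bar> * exp (- (N n * h n y)) \<partial>lborel)
      / (\<integral>y. exp (- (N n * h n y)) \<partial>lborel) - x) < r"
  proof eventually_elim
    case (elim n)
    define I where "I = (\<integral>y. exp (- (N n * h n y)) \<partial>lborel)"
    define E where "E = (\<lambda>y. exp (- (N n * h n y)))"
    define T where "T = exp (- ((N n - 1) * (g x + \<eta>)))"
    have low: "y\<^sup>2 - N n * C \<le> N n * h n y" for y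
    proof -
      have "N n * (y\<^sup>2 - C) \<le> N n * h n y" using elim by (intro mult_left_mono) auto
      moreover have "1 * y\<^sup>2 \<le> N n * y\<^sup>2" using elim by (intro mult_right_mono) auto
      ultimately show ?thesis by (simp add: algebra_simps)
    qed
    have int: "integrable lborel E" "integrable lborel (\<lambda>y. \<bar>y\<bar> * E y)"
      unfolding E_def using low
      by (auto intro!: integrable_exp_minus integrable_abs_exp_minus)
    have I: "2 * w * exp (- (N n * (g x + \<eta> / 2))) \<le> I"
    proof -
      have "exp (- (N n * (g x + \<eta> / 2))) * ((x + w) - (x - w)) \<le> (\<integral>y. E y \<partial>lborel)"
      proof (rule integral_ge_on_interval[OF int(1)])
        fix y assume y: "x - w \<le> y" "y \<le> x + w"
        then have "y \<in> {-R..R}" by (auto simp: R_def)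
        with elim have "dist (h n y) (g y) < \<eta> / 4" by blast
        moreover have "g y < g x + \<eta> / 4" using w(2)[of y] y by auto
        ultimately have "h n y \<le> g x + \<eta> / 2" by (simp add: dist_real_def abs_if split: if_splits)
        then show "exp (- (N n * (g x + \<eta> / 2))) \<le> E y"
          using elim by (simp add: E_def mult_left_mono)
      qed (use w in \<open>auto simp: E_def\<close>)
      then show ?thesis by (simp add: I_def E_def algebra_simps)
    qed
    then have I0: "0 < I" by (rule less_le_trans[rotated]) (use w in simp)
    have "\<bar>(\<integral>y. \<bar>y\<bar> * E y \<partial>lborel) - x * I\<bar> = \<bar>\<integral>y. (\<bar>y\<bar> - x) * E y \<partial>lborel\<bar>"
      using int by (simp add: I_def left_diff_distrib flip: E_def)
    also have "\<dots> \<le> (\<integral>y. \<bar>(\<bar>y\<bar> - x) * E y\<bar> \<partial>lborel)"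
      by (rule integral_abs_bound)
    also have "\<dots> \<le> (\<integral>y. \<epsilon> * E y + T * ((\<bar>y\<bar> + \<bar>x\<bar>) * exp (- (y\<^sup>2 - C))) \<partial>lborel)"
    proof (rule integral_mono)
      show "integrable lborel (\<lambda>y. \<bar>(\<bar>y\<bar> - x) * E y\<bar>)"
        using int by (simp add: left_diff_distrib)
      show "integrable lborel (\<lambda>y. \<epsilon> * E y + T * ((\<bar>y\<bar> + \<bar>x\<bar>) * exp (- (y\<^sup>2 - C))))"
        using int Q_int by simp
      fix y :: real
      have E0: "0 < E y" by (simp add: E_def)
      have P0: "0 \<le> T * ((\<bar>y\<bar> + \<bar>x\<bar>) * exp (- (y\<^sup>2 - C)))" by (simp add: T_def)
      show "\<bar>(\<bar>y\<bar> - x) * E y\<bar> \<le> \<epsilon> * E y + T * ((\<bar>y\<bar> + \<bar>x\<bar>) * exp (- (y\<^sup>2 - C)))"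
      proof (cases "\<bar>\<bar>y\<bar> - x\<bar> < \<epsilon>")
        case True
        then have "\<bar>\<bar>y\<bar> - x\<bar> * E y \<le> \<epsilon> * E y" using E0 by (intro mult_right_mono) auto
        moreover have "\<bar>(\<bar>y\<bar> - x) * E y\<bar> = \<bar>\<bar>y\<bar> - x\<bar> * E y" using E0 by (simp add: abs_mult)
        ultimately show ?thesis using P0 by linarith
      next
        case False
        then have "g x + \<eta> \<le> h n y" using elim by auto
        then have "(N n - 1) * (g x + \<eta>) \<le> (N n - 1) * h n y"
          using elim by (intro mult_left_mono) auto
        moreover have "y\<^sup>2 - C \<le> h n y" using elim by blast
        \<comment> \<open>One of the \<open>N n\<close> copies of \<open>h n y\<close> is spent on integrability, the others on smallness.\<close>
        ultimately have "E y \<le> T * exp (- (y\<^sup>2 - C))"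
          unfolding E_def T_def exp_add[symmetric] by (simp add: algebra_simps)
        then have "\<bar>\<bar>y\<bar> - x\<bar> * E y \<le> (\<bar>y\<bar> + \<bar>x\<bar>) * (T * exp (- (y\<^sup>2 - C)))"
          using E0 by (intro mult_mono) auto
        moreover have "0 \<le> \<epsilon> * E y" using \<epsilon> E0 by simp
        ultimately show ?thesis using E0 by (simp add: abs_mult mult_ac)
      qed
    qed
    also have "\<dots> = \<epsilon> * I + T * Q"
      using int Q_int by (simp add: I_def Q_def flip: E_def)
    also have "T * Q \<le> Q / (2 * w) * exp (g x + \<eta>) * exp (- (N n * (\<eta> / 2))) * I"
    proof -
      have "T = exp (g x + \<eta>) * exp (- (N n * (\<eta> / 2))) * exp (- (N n * (g x + \<eta> / 2)))"
        unfolding T_def exp_add[symmetric] by (simp add: field_simps)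
      then have "T * Q = Q / (2 * w) * exp (g x + \<eta>) * exp (- (N n * (\<eta> / 2)))
          * (2 * w * exp (- (N n * (g x + \<eta> / 2))))"
        using w(1) by simp
      also have "\<dots> \<le> Q / (2 * w) * exp (g x + \<eta>) * exp (- (N n * (\<eta> / 2))) * I"
        using I Q0 w(1) by (intro mult_left_mono) auto
      finally show ?thesis .
    qed
    also have "\<epsilon> * I + Q / (2 * w) * exp (g x + \<eta>) * exp (- (N n * (\<eta> / 2))) * I < \<epsilon> * I + \<epsilon> * I"
      using elim I0 by (intro add_strict_left_mono mult_strict_right_mono) auto
    finally have "\<bar>(\<integral>y. \<bar>y\<bar> * E y \<partial>lborel) - x * I\<bar> < r * I" by (simp add: \<epsilon>_def algebra_simps)
    then have "\<bar>(\<integral>y. \<bar>y\<bar> * E y \<partial>lborel) - x * I\<bar> / I < r" using I0 by (simp add: divide_less_eq)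
    also have "\<bar>(\<integral>y. \<bar>y\<bar> * E y \<partial>lborel) - x * I\<bar> / I = \<bar>(\<integral>y. \<bar>y\<bar> * E y \<partial>lborel) / I - x\<bar>"
      using I0 by (simp add: field_simps abs_if)
    finally show ?case by (simp add: I_def E_def)
  qed
  then show "\<exists>n0. \<forall>n\<ge>n0. norm ((\<integral>y. \<bar>y\<bar> * exp (- (N n * h n y)) \<partial>lborel)
      / (\<integral>y. exp (- (N n * h n y)) \<partial>lborel) - x) < r"
    by (simp add: eventually_sequentially)
qed

lemma gibbs_abs_mean_converges:
  fixes h :: "nat \<Rightarrow> real \<Rightarrow> real" and g :: "real \<Rightarrow> real"
  assumes coercive: "\<forall>\<^sub>F n in sequentially. \<forall>y. y\<^sup>2 - C \<le> h n y"
    and lim: "\<And>y. (\<lambda>n. h n y) \<longlonglongrightarrow> g y"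
    and meas [measurable]: "\<And>n. h n \<in> borel_measurable borel"
  shows "(\<lambda>n. (\<integral>y. \<bar>y\<bar> * exp (- h n y) \<partial>lborel) / (\<integral>y. exp (- h n y) \<partial>lborel))
     \<longlonglongrightarrow> (\<integral>y. \<bar>y\<bar> * exp (- g y) \<partial>lborel) / (\<integral>y. exp (- g y) \<partial>lborel)"
proof -
  obtain n0 where n0: "\<And>n y. n0 \<le> n \<Longrightarrow> y\<^sup>2 - C \<le> h n y"
    using coercive by (auto simp: eventually_sequentially)
  have [measurable]: "g \<in> borel_measurable borel"
    by (rule borel_measurable_LIMSEQ_real[OF lim]) auto
  have g: "y\<^sup>2 - C \<le> g y" for y
    using n0 by (intro LIMSEQ_le_const[OF lim[of y]]) auto
  have dom: "integrable lborel (\<lambda>y. exp (- (y\<^sup>2 - C)))" "integrable lborel (\<lambda>y. \<bar>y\<bar> * exp (- (y\<^sup>2 - C)))"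
    by (rule integrable_exp_minus[where C = C] integrable_abs_exp_minus[where C = C]; simp)+
  have 1: "(\<lambda>n. \<integral>y. exp (- h n y) \<partial>lborel) \<longlonglongrightarrow> (\<integral>y. exp (- g y) \<partial>lborel)"
  proof (rule LIMSEQ_offset[where k = n0], rule integral_dominated_convergence[OF _ _ dom(1)])
    show "AE y in lborel. (\<lambda>n. exp (- h (n + n0) y)) \<longlonglongrightarrow> exp (- g y)"
      by (intro AE_I2 tendsto_intros LIMSEQ_ignore_initial_segment lim)
  next
    show "AE y in lborel. norm (exp (- h (n + n0) y)) \<le> exp (- (y\<^sup>2 - C))" for n
      using n0[of "n + n0"] by (intro AE_I2) (simp del: minus_diff_eq)
  qed auto
  have 2: "(\<lambda>n. \<integral>y. \<bar>y\<bar> * exp (- h n y) \<partial>lborel) \<longlonglongrightarrow> (\<integral>y. \<bar>y\<bar> * exp (- g y) \<partial>lborel)"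
  proof (rule LIMSEQ_offset[where k = n0], rule integral_dominated_convergence[OF _ _ dom(2)])
    show "AE y in lborel. (\<lambda>n. \<bar>y\<bar> * exp (- h (n + n0) y)) \<longlonglongrightarrow> \<bar>y\<bar> * exp (- g y)"
      by (intro AE_I2 tendsto_intros LIMSEQ_ignore_initial_segment lim)
  next
    show "AE y in lborel. norm (\<bar>y\<bar> * exp (- h (n + n0) y)) \<le> \<bar>y\<bar> * exp (- (y\<^sup>2 - C))" for n
      using n0[of "n + n0"] by (intro AE_I2) (simp add: abs_mult mult_left_mono del: minus_diff_eq)
  qed auto
  have "0 < (\<integral>y. exp (- g y) \<partial>lborel)"
    using g by (intro integral_pos_off_zero integrable_exp_minus) auto
  with 1 2 show ?thesis by (intro tendsto_divide) auto
qed

section \<open>Sandwiched quartic functionals\<close>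

text \<open>The lower bound carries a damping factor \<open>1 / (1 + d n y\<^sup>2)\<close>, which tends to one on compact sets
  since \<open>y ^ 4 / (1 + d y\<^sup>2) \<ge> y ^ 4 - d y ^ 6\<close>.\<close>

lemma uniform_limit_quartic_sandwich:
  fixes h :: "nat \<Rightarrow> real \<Rightarrow> real" and a b b' d e :: "nat \<Rightarrow> real"
  assumes a: "a \<longlonglongrightarrow> A" and b: "b \<longlonglongrightarrow> B" and b': "b' \<longlonglongrightarrow> B"
    and d: "d \<longlonglongrightarrow> 0" and e: "e \<longlonglongrightarrow> 0"
    and lower: "\<forall>\<^sub>F n in sequentially. 0 \<le> b n \<and> 0 \<le> d n \<and>
      (\<forall>y. a n * y\<^sup>2 + b n * (y ^ 4 / (1 + d n * y\<^sup>2)) \<le> h n y)"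
    and upper: "\<And>R. \<forall>\<^sub>F n in sequentially. \<forall>y. \<bar>y\<bar> \<le> R \<longrightarrow>
      h n y \<le> a n * y\<^sup>2 + b' n * y ^ 4 + e n * y ^ 6"
  shows "uniform_limit {-R..R} h (\<lambda>y. A * y\<^sup>2 + B * y ^ 4) sequentially"
proof (rule uniform_limitI)
  fix \<epsilon> :: real assume \<epsilon>: "0 < \<epsilon>"
  define w where "w = (\<lambda>n. \<bar>a n - A\<bar> * R\<^sup>2 + (\<bar>b n - B\<bar> + \<bar>b' n - B\<bar>) * R ^ 4
      + (b n * d n + \<bar>e n\<bar>) * R ^ 6)"
  have "w \<longlonglongrightarrow> \<bar>A - A\<bar> * R\<^sup>2 + (\<bar>B - B\<bar> + \<bar>B - B\<bar>) * R ^ 4 + (B * 0 + \<bar>0\<bar>) * R ^ 6"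
    unfolding w_def by (intro tendsto_intros a b b' d e)
  then have "\<forall>\<^sub>F n in sequentially. w n < \<epsilon>"
    using \<epsilon> by (intro order_tendstoD(2)[of w 0]) simp_all
  then show "\<forall>\<^sub>F n in sequentially. \<forall>y\<in>{-R..R}. dist (h n y) (A * y\<^sup>2 + B * y ^ 4) < \<epsilon>"
    using lower upper[of R]
  proof eventually_elim
    case (elim n)
    show ?case
    proof
      fix y assume "y \<in> {-R..R}"
      then have y: "\<bar>y\<bar> \<le> R" by auto
      have pw: "y\<^sup>2 \<le> R\<^sup>2" "y ^ 4 \<le> R ^ 4" "y ^ 6 \<le> R ^ 6"
        using power_mono[OF y, of 2] power_mono[OF y, of 4] power_mono[OF y, of 6]
        by (simp_all add: power_even_abs)
      have 1: "\<bar>(a n - A) * y\<^sup>2\<bar> \<le> \<bar>a n - A\<bar> * R\<^sup>2"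
        unfolding abs_mult using pw by (intro mult_left_mono) auto
      have 2: "\<bar>(b n - B) * y ^ 4\<bar> \<le> \<bar>b n - B\<bar> * R ^ 4" "\<bar>(b' n - B) * y ^ 4\<bar> \<le> \<bar>b' n - B\<bar> * R ^ 4"
        unfolding abs_mult using pw by (auto intro!: mult_left_mono)
      have 3: "\<bar>e n * y ^ 6\<bar> \<le> \<bar>e n\<bar> * R ^ 6"
        unfolding abs_mult using pw by (auto intro!: mult_left_mono)
      have 4: "b n * d n * y ^ 6 \<le> b n * d n * R ^ 6"
        using pw elim by (intro mult_left_mono) auto
      have R0: "0 \<le> \<bar>b n - B\<bar> * R ^ 4" "0 \<le> \<bar>b' n - B\<bar> * R ^ 4" "0 \<le> \<bar>e n\<bar> * R ^ 6"
          "0 \<le> b n * d n * R ^ 6"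
        using elim by auto
      have "y ^ 4 - d n * y ^ 6 \<le> y ^ 4 / (1 + d n * y\<^sup>2)"
      proof -
        have "0 < 1 + d n * y\<^sup>2" using elim by (intro add_pos_nonneg) auto
        moreover have "(y ^ 4 - d n * y ^ 6) * (1 + d n * y\<^sup>2) = y ^ 4 - (d n)\<^sup>2 * y ^ 8"
          by (simp add: algebra_simps power2_eq_square eval_nat_numeral)
        moreover have "\<dots> \<le> y ^ 4" by simp
        ultimately show ?thesis by (simp add: le_divide_eq)
      qed
      then have "b n * (y ^ 4 - d n * y ^ 6) \<le> b n * (y ^ 4 / (1 + d n * y\<^sup>2))"
        using elim by (intro mult_left_mono) auto
      moreover have "a n * y\<^sup>2 + b n * (y ^ 4 / (1 + d n * y\<^sup>2)) \<le> h n y" using elim by blast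
      ultimately have low: "a n * y\<^sup>2 + b n * (y ^ 4 - d n * y ^ 6) \<le> h n y" by linarith
      have up: "h n y \<le> a n * y\<^sup>2 + b' n * y ^ 4 + e n * y ^ 6" using elim y by blast
      define p1 p2 p3 p4 p5 where "p1 = \<bar>a n - A\<bar> * R\<^sup>2" and "p2 = \<bar>b n - B\<bar> * R ^ 4"
        and "p3 = \<bar>b' n - B\<bar> * R ^ 4" and "p4 = \<bar>e n\<bar> * R ^ 6" and "p5 = b n * d n * R ^ 6"
      note p = p1_def[symmetric] p2_def[symmetric] p3_def[symmetric] p4_def[symmetric] p5_def[symmetric]
      have w: "w n = p1 + (p2 + p3) + (p5 + p4)"
        by (simp add: w_def p1_def p2_def p3_def p4_def p5_def distrib_right)
      note bounds = 1[unfolded p, THEN abs_le_D1] 1[unfolded p, THEN abs_le_D2]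
        2(1)[unfolded p, THEN abs_le_D2] 2(2)[unfolded p, THEN abs_le_D1]
        3[unfolded p, THEN abs_le_D1] 4[unfolded p] R0[unfolded p]
      have "h n y - (A * y\<^sup>2 + B * y ^ 4) \<le> (a n - A) * y\<^sup>2 + (b' n - B) * y ^ 4 + e n * y ^ 6"
        using up unfolding left_diff_distrib by linarith
      then have "h n y - (A * y\<^sup>2 + B * y ^ 4) \<le> w n"
        using bounds unfolding w by linarith
      moreover have "- (h n y - (A * y\<^sup>2 + B * y ^ 4))
          \<le> - ((a n - A) * y\<^sup>2) + - ((b n - B) * y ^ 4) + b n * d n * y ^ 6"
        using low unfolding left_diff_distrib right_diff_distrib mult.assoc by linarith
      then have "- (h n y - (A * y\<^sup>2 + B * y ^ 4)) \<le> w n"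
        using bounds unfolding w by linarith
      ultimately have "\<bar>h n y - (A * y\<^sup>2 + B * y ^ 4)\<bar> \<le> w n" by (rule abs_leI)
      then show "dist (h n y) (A * y\<^sup>2 + B * y ^ 4) < \<epsilon>" using elim by (simp add: dist_real_def)
    qed
  qed
qed

text \<open>The damped quartic term grows only like \<open>b n y\<^sup>2 / d n\<close>. Because \<open>d n\<close> tends to zero, this
  quadratic growth has an arbitrarily large factor and absorbs the term \<open>a n y\<^sup>2\<close>, whatever its
  sign.\<close>

lemma coercive_quartic_sandwich:
  fixes h :: "nat \<Rightarrow> real \<Rightarrow> real" and a b d :: "nat \<Rightarrow> real"
  assumes a: "a \<longlonglongrightarrow> A" and b: "b \<longlonglongrightarrow> B" and d: "d \<longlonglongrightarrow> 0" and B: "0 < B"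
    and lower: "\<forall>\<^sub>F n in sequentially. 0 \<le> b n \<and> 0 \<le> d n \<and>
      (\<forall>y. a n * y\<^sup>2 + b n * (y ^ 4 / (1 + d n * y\<^sup>2)) \<le> h n y)"
  shows "\<exists>C. \<forall>\<^sub>F n in sequentially. \<forall>y. y\<^sup>2 - C \<le> h n y"
proof -
  define c where "c = \<bar>A\<bar> + 2"
  \<comment> \<open>With damping \<open>\<delta>\<close>, half of the quartic coefficient yields growth \<open>c y\<^sup>2\<close>, one more than the
    quadratic term can take away.\<close>
  define \<delta> where "\<delta> = B / (2 * c)"
  have c: "0 < c" by (simp add: c_def)
  then have \<delta>: "0 < \<delta>" "B / 2 = c * \<delta>" using B by (auto simp: \<delta>_def)
  have "\<forall>\<^sub>F n in sequentially. 1 - c < a n" using a by (rule order_tendstoD) (simp add: c_def)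
  moreover have "\<forall>\<^sub>F n in sequentially. B / 2 < b n" using b by (rule order_tendstoD) (use B in simp)
  moreover have "\<forall>\<^sub>F n in sequentially. d n < \<delta>" using d \<delta>(1) by (rule order_tendstoD)
  ultimately have "\<forall>\<^sub>F n in sequentially. \<forall>y. y\<^sup>2 - c / \<delta> \<le> h n y"
    using lower
  proof eventually_elim
    case (elim n)
    show ?case
    proof
      fix y :: real
      have pos: "0 < 1 + d n * y\<^sup>2" "0 < 1 + \<delta> * y\<^sup>2"
        using elim \<delta> by (auto intro!: add_pos_nonneg)
      have "c * y\<^sup>2 - c / \<delta> = c * \<delta> * ((\<delta> * y\<^sup>2 - 1) / \<delta>\<^sup>2)"
        using \<delta>(1) by (simp add: field_simps power2_eq_square)
      also have "(\<delta> * y\<^sup>2 - 1) / \<delta>\<^sup>2 \<le> y ^ 4 / (1 + \<delta> * y\<^sup>2)"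
      proof -
        have "(\<delta> * y\<^sup>2 - 1) * (1 + \<delta> * y\<^sup>2) \<le> y ^ 4 * \<delta>\<^sup>2"
          by (simp add: algebra_simps power2_eq_square eval_nat_numeral)
        then show ?thesis using pos \<delta>(1) by (simp add: frac_le_eq divide_le_0_iff)
      qed
      also have "y ^ 4 / (1 + \<delta> * y\<^sup>2) \<le> y ^ 4 / (1 + d n * y\<^sup>2)"
        using pos elim by (intro divide_left_mono add_left_mono mult_right_mono mult_pos_pos) auto
      also have "c * \<delta> * (y ^ 4 / (1 + d n * y\<^sup>2)) \<le> b n * (y ^ 4 / (1 + d n * y\<^sup>2))"
        using pos elim \<delta>(2) by (intro mult_right_mono divide_nonneg_pos) auto
      finally have "c * y\<^sup>2 - c / \<delta> \<le> b n * (y ^ 4 / (1 + d n * y\<^sup>2))"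
        using c \<delta> by simp
      moreover have "(1 - c) * y\<^sup>2 \<le> a n * y\<^sup>2" using elim by (intro mult_right_mono) auto
      ultimately have "y\<^sup>2 - c / \<delta> \<le> a n * y\<^sup>2 + b n * (y ^ 4 / (1 + d n * y\<^sup>2))"
        by (simp add: left_diff_distrib)
      moreover have "a n * y\<^sup>2 + b n * (y ^ 4 / (1 + d n * y\<^sup>2)) \<le> h n y" using elim by blast
      ultimately show "y\<^sup>2 - c / \<delta> \<le> h n y" by linarith
    qed
  qed
  then show ?thesis by blast
qed

section \<open>The double well\<close>

lemma coercive_attains_min:
  fixes f :: "real \<Rightarrow> real"
  assumes cont: "continuous_on UNIV f" and co: "\<And>y. y\<^sup>2 - C \<le> f y"
  shows "\<exists>x. x \<in> global_min_points f"
proof -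
  define R where "R = 1 + \<bar>C + f 0\<bar>"
  have R: "C + f 0 \<le> R\<^sup>2" "0 < R"
  proof -
    have "R * 1 \<le> R * R" unfolding R_def by (intro mult_left_mono) auto
    then show "C + f 0 \<le> R\<^sup>2" unfolding power2_eq_square using R_def by linarith
  qed (simp add: R_def)
  obtain x where x: "x \<in> {-R..R}" "\<And>y. y \<in> {-R..R} \<Longrightarrow> f x \<le> f y"
    using continuous_attains_inf[of "{-R..R}" f] continuous_on_subset[OF cont] R(2) by force
  have "f x \<le> f y" for y
  proof (cases "y \<in> {-R..R}")
    case False
    then have "R\<^sup>2 \<le> \<bar>y\<bar>\<^sup>2" using R(2) by (intro power_mono) auto
    then have "f 0 \<le> f y" using co[of y] R(1) by simp
    then show ?thesis using x(2)[of 0] R(2) by simp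
  qed (rule x(2))
  then show ?thesis by (auto simp: global_min_points_def)
qed

lemma double_well:
  fixes A B :: real
  assumes "A < 0" "0 < B"
  defines "x \<equiv> sqrt (- A / (2 * B))"
  shows double_well_min_pos: "0 < x"
    and double_well_pos_min_point: "pos_min_point (\<lambda>y. A * y\<^sup>2 + B * y ^ 4) = x"
    and double_well_separated: "0 < \<epsilon> \<Longrightarrow> \<exists>\<eta>>0. \<forall>y. \<epsilon> \<le> \<bar>\<bar>y\<bar> - x\<bar> \<longrightarrow>
      A * x\<^sup>2 + B * x ^ 4 + \<eta> \<le> A * y\<^sup>2 + B * y ^ 4"
proof -
  show x0: "0 < x" using assms by (simp add: x_def divide_neg_pos)
  have x2: "A = - 2 * B * x\<^sup>2"
    using assms by (simp add: x_def divide_nonpos_pos)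
  have sq: "A * y\<^sup>2 + B * y ^ 4 = (A * x\<^sup>2 + B * x ^ 4) + B * (y\<^sup>2 - x\<^sup>2)\<^sup>2" for y
    unfolding x2 by (simp add: power2_eq_square algebra_simps eval_nat_numeral)
  show "pos_min_point (\<lambda>y. A * y\<^sup>2 + B * y ^ 4) = x"
    unfolding pos_min_point_def
  proof (rule the_equality)
    have "A * x\<^sup>2 + B * x ^ 4 \<le> A * y\<^sup>2 + B * y ^ 4" for y
      unfolding sq[of y] using assms(2) by simp
    then show "0 < x \<and> x \<in> global_min_points (\<lambda>y. A * y\<^sup>2 + B * y ^ 4)"
      using x0 by (simp add: global_min_points_def)
    fix z assume z: "0 < z \<and> z \<in> global_min_points (\<lambda>y. A * y\<^sup>2 + B * y ^ 4)"
    then have "A * z\<^sup>2 + B * z ^ 4 \<le> A * x\<^sup>2 + B * x ^ 4" by (simp add: global_min_points_def)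
    then have "B * (z\<^sup>2 - x\<^sup>2)\<^sup>2 \<le> 0" using sq[of z] by simp
    then have "z\<^sup>2 = x\<^sup>2" using assms(2) by (simp add: mult_le_0_iff)
    then show "z = x" using z x0 by (simp add: power2_eq_iff_nonneg)
  qed
  \<comment> \<open>The factor \<open>\<bar>y\<bar> + x\<close> of \<open>y\<^sup>2 - x\<^sup>2\<close> is at least \<open>x\<close>.\<close>
  show "\<exists>\<eta>>0. \<forall>y. \<epsilon> \<le> \<bar>\<bar>y\<bar> - x\<bar> \<longrightarrow> A * x\<^sup>2 + B * x ^ 4 + \<eta> \<le> A * y\<^sup>2 + B * y ^ 4" if "0 < \<epsilon>"
  proof (intro exI[of _ "B * (\<epsilon> * x)\<^sup>2"] conjI allI impI)
    show "0 < B * (\<epsilon> * x)\<^sup>2" using assms(2) x0 that by simp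
    fix y assume y: "\<epsilon> \<le> \<bar>\<bar>y\<bar> - x\<bar>"
    have "y\<^sup>2 - x\<^sup>2 = (\<bar>y\<bar> - x) * (\<bar>y\<bar> + x)"
      by (simp add: square_diff_square_factored[symmetric] power2_eq_square algebra_simps)
    then have "\<bar>y\<^sup>2 - x\<^sup>2\<bar> = \<bar>\<bar>y\<bar> - x\<bar> * (\<bar>y\<bar> + x)" using x0 by (simp add: abs_mult)
    moreover have "\<epsilon> * x \<le> \<bar>\<bar>y\<bar> - x\<bar> * (\<bar>y\<bar> + x)" using y x0 that by (intro mult_mono) auto
    ultimately have "(\<epsilon> * x)\<^sup>2 \<le> \<bar>y\<^sup>2 - x\<^sup>2\<bar>\<^sup>2" using x0 that by (intro power_mono) auto
    then show "A * x\<^sup>2 + B * x ^ 4 + B * (\<epsilon> * x)\<^sup>2 \<le> A * y\<^sup>2 + B * y ^ 4"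
      using assms(2) unfolding sq[of y] by simp
  qed
qed

section \<open>Gaussian smoothing of the spin distribution\<close>

lemma finite_configs: "finite (configs n)"
  by (simp add: configs_def spins_def finite_PiE)

lemma partition_fun_pos: "0 < partition_fun n \<beta> K"
proof -
  have "configs n \<noteq> {}" by (simp add: configs_def spins_def PiE_eq_empty_iff)
  then show ?thesis unfolding partition_fun_def using finite_configs by (intro sum_pos) auto
qed

lemma mean_abs_spin_eq_sum:
  "mean_abs_spin n \<beta> K =
    (\<Sum>\<omega>\<in>configs n. exp (- \<beta> * hamiltonian n K \<omega>) * \<bar>total_spin n \<omega> / real n\<bar>) / partition_fun n \<beta> K"
proof -
  have "mean_abs_spin n \<beta> K = (\<Sum>\<omega>\<in>configs n.
      (exp (- \<beta> * hamiltonian n K \<omega>) / partition_fun n \<beta> K) *\<^sub>R \<bar>total_spin n \<omega> / real n\<bar>)"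
    unfolding mean_abs_spin_def blume_capel_def
    using partition_fun_pos[of n \<beta> K]
    by (intro lebesgue_integral_point_measure_finite finite_configs) auto
  then show ?thesis by (simp add: sum_divide_distrib mult.commute)
qed

lemma sum_configs_exp:
  "(\<Sum>\<omega>\<in>configs n. exp (- \<beta> * (\<Sum>j=1..n. (\<omega> j)\<^sup>2) + t * total_spin n \<omega>))
    = (1 + exp (- \<beta>) * (exp t + exp (- t))) ^ n"
proof -
  have "(\<Prod>j\<in>{1..n}. \<Sum>s\<in>spins. exp (- \<beta> * s\<^sup>2 + t * s))
      = (\<Sum>\<omega>\<in>configs n. \<Prod>j\<in>{1..n}. exp (- \<beta> * (\<omega> j)\<^sup>2 + t * \<omega> j))"
    unfolding configs_def by (intro prod_sum_PiE) (auto simp: spins_def)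
  moreover have "(\<Sum>s\<in>spins. exp (- \<beta> * s\<^sup>2 + t * s)) = 1 + exp (- \<beta>) * (exp t + exp (- t))"
    by (simp add: spins_def distrib_left flip: exp_add)
  moreover have "(\<Prod>j\<in>{1..n}. exp (- \<beta> * (\<omega> j)\<^sup>2 + t * \<omega> j))
      = exp (- \<beta> * (\<Sum>j=1..n. (\<omega> j)\<^sup>2) + t * total_spin n \<omega>)" for \<omega> :: "nat \<Rightarrow> real"
    by (simp only: total_spin_def sum_distrib_left exp_sum sum.distrib[symmetric] finite_atLeastAtMost)
  ultimately show ?thesis by simp
qed

text \<open>Hubbard--Stratonovich transformation: the Gaussian factor cancels the interaction
  \<open>exp (\<beta> K S\<^sup>2 / n)\<close> of the Hamiltonian and leaves a term linear in \<open>S\<close>, so that the sum over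
  configurations factorizes over the sites.\<close>

lemma gibbs_gaussian_mixture:
  assumes "0 < n"
  shows "(\<Sum>\<omega>\<in>configs n. exp (- \<beta> * hamiltonian n K \<omega>)
            * exp (- (real n * \<beta> * K) * (x - total_spin n \<omega> / real n)\<^sup>2))
    = (1 + 2 * exp (- \<beta>)) ^ n * exp (- (real n * free_energy \<beta> K x))"
proof -
  have D: "0 < 1 + 2 * exp (- \<beta>)" by (simp add: add_pos_pos)
  have num: "0 < 1 + exp (- \<beta>) * (exp t + exp (- t))" for t by (simp add: add_pos_pos)
  have "exp (- \<beta> * hamiltonian n K \<omega>) * exp (- (real n * \<beta> * K) * (x - total_spin n \<omega> / real n)\<^sup>2)
      = exp (- (real n * \<beta> * K * x\<^sup>2))
        * exp (- \<beta> * (\<Sum>j=1..n. (\<omega> j)\<^sup>2) + (2 * \<beta> * K * x) * total_spin n \<omega>)" for \<omega>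
    using assms unfolding exp_add[symmetric] hamiltonian_def total_spin_def[symmetric]
    by (simp add: field_simps power2_eq_square)
  then have "(\<Sum>\<omega>\<in>configs n. exp (- \<beta> * hamiltonian n K \<omega>)
            * exp (- (real n * \<beta> * K) * (x - total_spin n \<omega> / real n)\<^sup>2))
      = exp (- (real n * \<beta> * K * x\<^sup>2))
        * (1 + exp (- \<beta>) * (exp (2 * \<beta> * K * x) + exp (- (2 * \<beta> * K * x)))) ^ n"
    by (simp only: sum_configs_exp sum_distrib_left[symmetric])
  also have "1 + exp (- \<beta>) * (exp (2 * \<beta> * K * x) + exp (- (2 * \<beta> * K * x)))
      = (1 + 2 * exp (- \<beta>)) * exp (cumulant \<beta> (2 * \<beta> * K * x))"
    using D num[of "2 * \<beta> * K * x"] by (simp add: cumulant_def)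
  also have "exp (- (real n * \<beta> * K * x\<^sup>2))
        * ((1 + 2 * exp (- \<beta>)) * exp (cumulant \<beta> (2 * \<beta> * K * x))) ^ n
      = (1 + 2 * exp (- \<beta>)) ^ n * exp (- (real n * free_energy \<beta> K x))"
    by (simp add: free_energy_def power_mult_distrib exp_of_nat_mult[symmetric] right_diff_distrib
        mult.assoc flip: exp_add)
  finally show ?thesis .
qed

text \<open>By \<open>gibbs_gaussian_mixture\<close> the density \<open>exp (- n free_energy)\<close> is, up to a constant, the law of
  \<open>S / n\<close> convolved with a Gaussian. Convolution moves \<open>\<bar>S / n\<bar>\<close> by at most the mean absolute value
  of the Gaussian, which is \<open>1 / sqrt (\<pi> a)\<close> for the kernel \<open>exp (- a u\<^sup>2)\<close>.\<close>

lemma mean_abs_spin_smoothed: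
  assumes n: "0 < n" and \<beta>: "0 < \<beta>" and K: "0 < K"
  shows "\<bar>mean_abs_spin n \<beta> K
      - (\<integral>x. \<bar>x\<bar> * exp (- (real n * free_energy \<beta> K x)) \<partial>lborel)
        / (\<integral>x. exp (- (real n * free_energy \<beta> K x)) \<partial>lborel)\<bar>
    \<le> 1 / sqrt (pi * (real n * \<beta> * K))"
proof -
  define a where "a = real n * \<beta> * K"
  have a: "0 < a" using assms by (simp add: a_def)
  define D where "D = (1 + 2 * exp (- \<beta>)) ^ n"
  have D: "0 < D" by (simp add: D_def add_pos_pos)
  define w where "w = (\<lambda>\<omega>. exp (- \<beta> * hamiltonian n K \<omega>))"
  define s where "s = (\<lambda>\<omega>. total_spin n \<omega> / real n)"
  define e where "e = (\<lambda>\<omega> x. exp (- a * (x - s \<omega>)\<^sup>2))"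
  define Z where "Z = partition_fun n \<beta> K"
  have Z: "0 < Z" "Z = (\<Sum>\<omega>\<in>configs n. w \<omega>)"
    using partition_fun_pos by (auto simp: Z_def partition_fun_def w_def)
  define F where "F = (\<lambda>x. exp (- (real n * free_energy \<beta> K x)))"
  have F: "F x = (\<Sum>\<omega>\<in>configs n. w \<omega> * e \<omega> x) / D" for x
    using gibbs_gaussian_mixture[OF n, of \<beta> K x] D
    by (simp add: F_def w_def e_def a_def s_def D_def del: power_eq_0_iff)
  have int_e: "integrable lborel (e \<omega>)" "(\<integral>x. e \<omega> x \<partial>lborel) = sqrt (pi / a)" for \<omega>
    unfolding e_def using gaussian_has_integral[OF a]
    by (auto simp: has_bochner_integral_iff)
  have int_d: "integrable lborel (\<lambda>x. \<bar>x - s \<omega>\<bar> * e \<omega> x)"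
    "(\<integral>x. \<bar>x - s \<omega>\<bar> * e \<omega> x \<partial>lborel) = 1 / a" for \<omega>
    unfolding e_def using gaussian_abs_has_integral[OF a]
    by (auto simp: has_bochner_integral_iff)
  have e0: "0 < e \<omega> x" for \<omega> x by (simp add: e_def)
  have [measurable]: "e \<omega> \<in> borel_measurable borel" for \<omega> by (simp add: e_def)
  have int_a: "integrable lborel (\<lambda>x. \<bar>x\<bar> * e \<omega> x)" for \<omega>
  proof (rule Bochner_Integration.integrable_bound)
    show "integrable lborel (\<lambda>x. \<bar>x - s \<omega>\<bar> * e \<omega> x + \<bar>s \<omega>\<bar> * e \<omega> x)"
      using int_d(1)[of \<omega>] int_e(1)[of \<omega>] by simp
    show "AE x in lborel. norm (\<bar>x\<bar> * e \<omega> x) \<le> norm (\<bar>x - s \<omega>\<bar> * e \<omega> x + \<bar>s \<omega>\<bar> * e \<omega> x)"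
      unfolding distrib_right[symmetric] using e0
      by (intro AE_I2) (simp add: abs_mult mult_right_mono)
  qed simp
  have I: "(\<integral>x. F x \<partial>lborel) = Z * sqrt (pi / a) / D"
    unfolding F using int_e by (simp add: Z(2) sum_distrib_right)
  have "(\<integral>x. \<bar>x\<bar> * F x \<partial>lborel) = (\<integral>x. (\<Sum>\<omega>\<in>configs n. w \<omega> * (\<bar>x\<bar> * e \<omega> x)) / D \<partial>lborel)"
    unfolding F by (simp add: sum_distrib_left mult_ac)
  also have "\<dots> = (\<Sum>\<omega>\<in>configs n. w \<omega> * (\<integral>x. \<bar>x\<bar> * e \<omega> x \<partial>lborel)) / D"
    using int_a by simp
  finally have J: "(\<integral>x. \<bar>x\<bar> * F x \<partial>lborel) = (\<Sum>\<omega>\<in>configs n. w \<omega> * (\<integral>x. \<bar>x\<bar> * e \<omega> x \<partial>lborel)) / D" .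
  have close: "\<bar>\<bar>s \<omega>\<bar> * sqrt (pi / a) - (\<integral>x. \<bar>x\<bar> * e \<omega> x \<partial>lborel)\<bar> \<le> 1 / a" for \<omega>
  proof -
    have "\<bar>s \<omega>\<bar> * sqrt (pi / a) - (\<integral>x. \<bar>x\<bar> * e \<omega> x \<partial>lborel) = (\<integral>x. (\<bar>s \<omega>\<bar> - \<bar>x\<bar>) * e \<omega> x \<partial>lborel)"
      using int_e int_a by (simp add: left_diff_distrib)
    also have "\<bar>\<dots>\<bar> \<le> (\<integral>x. \<bar>(\<bar>s \<omega>\<bar> - \<bar>x\<bar>) * e \<omega> x\<bar> \<partial>lborel)"
      by (rule integral_abs_bound)
    also have "\<dots> \<le> (\<integral>x. \<bar>x - s \<omega>\<bar> * e \<omega> x \<partial>lborel)"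
    proof (rule integral_mono)
      show "integrable lborel (\<lambda>x. \<bar>(\<bar>s \<omega>\<bar> - \<bar>x\<bar>) * e \<omega> x\<bar>)"
        using int_e int_a by (simp add: left_diff_distrib)
      show "\<bar>(\<bar>s \<omega>\<bar> - \<bar>x\<bar>) * e \<omega> x\<bar> \<le> \<bar>x - s \<omega>\<bar> * e \<omega> x" for x
        using e0[of \<omega> x] unfolding abs_mult by (intro mult_mono) auto
    qed (rule int_d)
    finally show ?thesis by (simp add: int_d)
  qed
  have "\<bar>(\<Sum>\<omega>\<in>configs n. w \<omega> * \<bar>s \<omega>\<bar>) * sqrt (pi / a) - (\<Sum>\<omega>\<in>configs n. w \<omega> * (\<integral>x. \<bar>x\<bar> * e \<omega> x \<partial>lborel))\<bar>
      = \<bar>\<Sum>\<omega>\<in>configs n. w \<omega> * (\<bar>s \<omega>\<bar> * sqrt (pi / a) - (\<integral>x. \<bar>x\<bar> * e \<omega> x \<partial>lborel))\<bar>"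
    by (simp add: sum_distrib_right right_diff_distrib mult.assoc sum_subtractf)
  also have "\<dots> \<le> (\<Sum>\<omega>\<in>configs n. \<bar>w \<omega> * (\<bar>s \<omega>\<bar> * sqrt (pi / a) - (\<integral>x. \<bar>x\<bar> * e \<omega> x \<partial>lborel))\<bar>)"
    by (rule sum_abs)
  also have "\<dots> \<le> (\<Sum>\<omega>\<in>configs n. w \<omega> * (1 / a))"
    unfolding abs_mult using close by (intro sum_mono mult_mono) (auto simp: w_def)
  also have "\<dots> = Z / a" by (simp add: Z(2) sum_divide_distrib)
  finally have *: "\<bar>(\<Sum>\<omega>\<in>configs n. w \<omega> * \<bar>s \<omega>\<bar>) * sqrt (pi / a)
      - (\<Sum>\<omega>\<in>configs n. w \<omega> * (\<integral>x. \<bar>x\<bar> * e \<omega> x \<partial>lborel))\<bar> \<le> Z / a" .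
  have r: "0 < sqrt (pi / a)" using a by simp
  have mean: "mean_abs_spin n \<beta> K = (\<Sum>\<omega>\<in>configs n. w \<omega> * \<bar>s \<omega>\<bar>) / Z"
    by (simp add: mean_abs_spin_eq_sum w_def s_def Z_def)
  have "mean_abs_spin n \<beta> K - (\<integral>x. \<bar>x\<bar> * F x \<partial>lborel) / (\<integral>x. F x \<partial>lborel)
      = ((\<Sum>\<omega>\<in>configs n. w \<omega> * \<bar>s \<omega>\<bar>) * sqrt (pi / a)
         - (\<Sum>\<omega>\<in>configs n. w \<omega> * (\<integral>x. \<bar>x\<bar> * e \<omega> x \<partial>lborel))) / (Z * sqrt (pi / a))"
    unfolding I J mean using D Z(1) r by (simp add: diff_divide_distrib del: real_sqrt_eq_zero_cancel_iff real_sqrt_gt_0_iff)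
  also have "\<bar>\<dots>\<bar> \<le> (Z / a) / (Z * sqrt (pi / a))"
    unfolding abs_divide using * Z r by (intro divide_mono) auto
  also have "\<dots> = 1 / (a * sqrt (pi / a))" using Z by simp
  also have "a * sqrt (pi / a) = sqrt (pi * a)"
    using a by (simp add: real_sqrt_divide real_sqrt_mult real_div_sqrt field_simps)
  finally show ?thesis by (simp add: F_def a_def)
qed

section \<open>Derivatives of the critical curve\<close>

text \<open>The functions \<open>exp x P(1 / x) + Q(1 / x)\<close> are closed under differentiation; since the critical
  curve is one of them, it is smooth on the positive half-line.\<close>

lemma exp_poly_recip_deriv:
  fixes F :: "real \<Rightarrow> real" and P Q :: "real poly"
  assumes F: "\<And>x. 0 < x \<Longrightarrow> F x = exp x * poly P (1 / x) + poly Q (1 / x)" and x: "0 < x"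
  shows "(F has_real_derivative deriv F x) (at x)"
    and "deriv F x = exp x * poly (P - [:0, 0, 1:] * pderiv P) (1 / x) + poly (- [:0, 0, 1:] * pderiv Q) (1 / x)"
proof -
  have "((\<lambda>x. exp x * poly P (1 / x) + poly Q (1 / x)) has_real_derivative
      exp x * poly (P - [:0, 0, 1:] * pderiv P) (1 / x) + poly (- [:0, 0, 1:] * pderiv Q) (1 / x)) (at x)"
    using x by (auto intro!: derivative_eq_intros DERIV_chain'[OF _ poly_DERIV]
        simp: field_simps power2_eq_square)
  then have *: "(F has_real_derivative
      exp x * poly (P - [:0, 0, 1:] * pderiv P) (1 / x) + poly (- [:0, 0, 1:] * pderiv Q) (1 / x)) (at x)"
    by (rule has_field_derivative_transform_within_open[where S = "{0<..}"]) (use x F in auto)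
  then show "deriv F x = exp x * poly (P - [:0, 0, 1:] * pderiv P) (1 / x) + poly (- [:0, 0, 1:] * pderiv Q) (1 / x)"
    by (rule DERIV_imp_deriv)
  with * show "(F has_real_derivative deriv F x) (at x)" by simp
qed

lemma higher_deriv_K_curve:
  "\<exists>P Q :: real poly. \<forall>x>0. (deriv ^^ j) K_curve x = exp x * poly P (1 / x) + poly Q (1 / x)"
proof (induction j)
  case 0
  show ?case
    by (rule exI[of _ "[:0, 1 / 4:]"], rule exI[of _ "[:0, 1 / 2:]"]) (simp add: K_curve_def field_simps)
next
  case (Suc j)
  then obtain P Q :: "real poly" where
    "\<And>x. 0 < x \<Longrightarrow> (deriv ^^ j) K_curve x = exp x * poly P (1 / x) + poly Q (1 / x)"
    by blast
  from exp_poly_recip_deriv(2)[OF this] show ?case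
    unfolding funpow.simps comp_apply by blast
qed

lemma K_curve_has_derivs:
  assumes "0 < x"
  shows "((deriv ^^ j) K_curve has_real_derivative (deriv ^^ Suc j) K_curve x) (at x)"
proof -
  obtain P Q :: "real poly" where
    "\<And>x. 0 < x \<Longrightarrow> (deriv ^^ j) K_curve x = exp x * poly P (1 / x) + poly Q (1 / x)"
    using higher_deriv_K_curve by blast
  from exp_poly_recip_deriv(1)[OF this assms] show ?thesis by simp
qed

lemma beta_c_pos: "0 < beta_c"
  by (simp add: beta_c_def)

text \<open>Lagrange's form of the remainder evaluates the derivative of order \<open>p\<close> at an intermediate
  point, which tends to \<open>beta_c\<close>.\<close>

lemma K_curve_taylor_peano:
  assumes p: "0 < p"
  shows "((\<lambda>\<delta>. (K_curve (beta_c - \<delta>) - (\<Sum>j<p. K_deriv j * (- \<delta>) ^ j / fact j)) / \<delta> ^ p)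
     \<longlongrightarrow> K_deriv p * (-1) ^ p / fact p) (at_right 0)"
proof (rule tendstoI)
  fix \<epsilon> :: real assume \<epsilon>: "0 < \<epsilon>"
  have "isCont ((deriv ^^ p) K_curve) beta_c"
    using K_curve_has_derivs[OF beta_c_pos] by (rule DERIV_isCont)
  then have "((deriv ^^ p) K_curve \<longlongrightarrow> K_deriv p) (nhds beta_c)"
    by (simp add: continuous_at tendsto_nhds_iff)
  then have "\<forall>\<^sub>F t in nhds beta_c. dist ((deriv ^^ p) K_curve t) (K_deriv p) < \<epsilon> * fact p"
    using \<epsilon> by (intro tendstoD) auto
  then obtain d where d: "0 < d"
    "\<And>t. dist t beta_c < d \<Longrightarrow> dist ((deriv ^^ p) K_curve t) (K_deriv p) < \<epsilon> * fact p"
    by (auto simp: eventually_nhds_metric)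
  define d' where "d' = min d beta_c"
  have d': "0 < d'" using d beta_c_pos by (simp add: d'_def)
  show "\<forall>\<^sub>F \<delta> in at_right 0. dist ((K_curve (beta_c - \<delta>) - (\<Sum>j<p. K_deriv j * (- \<delta>) ^ j / fact j)) / \<delta> ^ p)
        (K_deriv p * (-1) ^ p / fact p) < \<epsilon>"
  proof (rule eventually_at_rightI[OF _ d'])
    fix \<delta> assume \<delta>: "\<delta> \<in> {0<..<d'}"
    have "\<exists>t. beta_c - \<delta> < t \<and> t < beta_c \<and> K_curve (beta_c - \<delta>)
        = (\<Sum>m<p. ((deriv ^^ m) K_curve beta_c / fact m) * (beta_c - \<delta> - beta_c) ^ m)
          + ((deriv ^^ p) K_curve t / fact p) * (beta_c - \<delta> - beta_c) ^ p"
    proof (rule Taylor_down[OF p])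
      show "\<forall>m t. m < p \<and> beta_c - \<delta> \<le> t \<and> t \<le> beta_c \<longrightarrow>
          ((deriv ^^ m) K_curve has_real_derivative (deriv ^^ Suc m) K_curve t) (at t)"
        using \<delta> by (intro allI impI K_curve_has_derivs) (auto simp: d'_def)
    qed (use \<delta> in auto)
    then obtain t where t: "beta_c - \<delta> < t" "t < beta_c"
      and T: "K_curve (beta_c - \<delta>) - (\<Sum>j<p. K_deriv j * (- \<delta>) ^ j / fact j)
          = (deriv ^^ p) K_curve t / fact p * (- \<delta>) ^ p"
      by auto
    have "(K_curve (beta_c - \<delta>) - (\<Sum>j<p. K_deriv j * (- \<delta>) ^ j / fact j)) / \<delta> ^ p
        = (deriv ^^ p) K_curve t * (-1) ^ p / fact p"
      unfolding T using \<delta> by (subst power_minus) simp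
    then have "dist ((K_curve (beta_c - \<delta>) - (\<Sum>j<p. K_deriv j * (- \<delta>) ^ j / fact j)) / \<delta> ^ p)
        (K_deriv p * (-1) ^ p / fact p) = dist ((deriv ^^ p) K_curve t) (K_deriv p) / fact p"
      by (simp add: dist_real_def abs_mult flip: diff_divide_distrib left_diff_distrib)
    also have "\<dots> < \<epsilon>"
      using d(2)[of t] t \<delta> by (auto simp: dist_real_def d'_def divide_less_eq)
    finally show "dist ((K_curve (beta_c - \<delta>) - (\<Sum>j<p. K_deriv j * (- \<delta>) ^ j / fact j)) / \<delta> ^ p)
        (K_deriv p * (-1) ^ p / fact p) < \<epsilon>" .
  qed
qed

section \<open>The free-energy functional\<close>

text \<open>The probability of a nonzero spin under the single-site measure with weights
  \<open>exp (- \<beta> s\<^sup>2)\<close>; the value \<open>1 / 3\<close> characterizes \<open>\<beta> = beta_c\<close>.\<close>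

definition spin_weight :: "real \<Rightarrow> real" where
  "spin_weight \<beta> = 2 / (exp \<beta> + 2)"

lemma cumulant_eq: "cumulant \<beta> t = ln (1 + spin_weight \<beta> * (cosh t - 1))"
proof -
  have e: "0 < exp \<beta> + 2" by (simp add: add_pos_pos)
  have "(1 + exp (- \<beta>) * (exp t + exp (- t))) / (1 + 2 * exp (- \<beta>)) = 1 + spin_weight \<beta> * (cosh t - 1)"
  proof -
    have "exp t + exp (- t) = 2 * cosh t" by (simp add: cosh_def)
    then show ?thesis
      using e by (simp add: spin_weight_def exp_minus[of \<beta>] divide_simps)
  qed
  then show ?thesis by (simp add: cumulant_def)
qed

lemma free_energy_even: "free_energy \<beta> K (- x) = free_energy \<beta> K x"
  by (simp add: free_energy_def cumulant_def add.commute)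

lemma free_energy_has_derivative:
  "(free_energy \<beta> K has_real_derivative
     2 * \<beta> * K * (x - 2 * sinh (2 * \<beta> * K * x) / (exp \<beta> + 2 * cosh (2 * \<beta> * K * x)))) (at x)"
proof -
  have w: "0 < spin_weight \<beta>" by (simp add: spin_weight_def add_pos_pos)
  have pos: "0 < 1 + spin_weight \<beta> * (cosh t - 1)" for t
    using w cosh_real_ge_1[of t] by (simp add: add_pos_nonneg)
  have fe: "free_energy \<beta> K = (\<lambda>x. \<beta> * K * x\<^sup>2 - ln (1 + spin_weight \<beta> * (cosh (2 * \<beta> * K * x) - 1)))"
    by (simp add: fun_eq_iff free_energy_def cumulant_eq)
  have "(free_energy \<beta> K has_real_derivative
     2 * \<beta> * K * x - spin_weight \<beta> * (sinh (2 * \<beta> * K * x) * (2 * \<beta> * K))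
       / (1 + spin_weight \<beta> * (cosh (2 * \<beta> * K * x) - 1))) (at x)"
    unfolding fe using pos[of "2 * \<beta> * K * x"]
    by (auto intro!: derivative_eq_intros)
  moreover have "spin_weight \<beta> * s / (1 + spin_weight \<beta> * (c - 1)) = 2 * s / (exp \<beta> + 2 * c)" 
    if "1 \<le> c" for s c
  proof -
    have "0 < exp \<beta> + 2" "0 < exp \<beta> + 2 * c" using that by (auto intro!: add_pos_pos)
    moreover have "1 + spin_weight \<beta> * (c - 1) = (exp \<beta> + 2 * c) / (exp \<beta> + 2)"
      using \<open>0 < exp \<beta> + 2\<close> by (simp add: spin_weight_def field_simps)
    ultimately show ?thesis by (simp add: spin_weight_def)
  qed
  from this[OF cosh_real_ge_1[of "2 * \<beta> * K * x"], of "sinh (2 * \<beta> * K * x) * (2 * \<beta> * K)"]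
  have "2 * \<beta> * K * x - spin_weight \<beta> * (sinh (2 * \<beta> * K * x) * (2 * \<beta> * K))
       / (1 + spin_weight \<beta> * (cosh (2 * \<beta> * K * x) - 1))
     = 2 * \<beta> * K * (x - 2 * sinh (2 * \<beta> * K * x) / (exp \<beta> + 2 * cosh (2 * \<beta> * K * x)))"
    by (simp add: right_diff_distrib)
  ultimately show ?thesis by simp
qed

lemma spin_weight_limit:
  "((\<lambda>\<delta>. (spin_weight (beta_c - \<delta>) - 1 / 3) / \<delta>) \<longlongrightarrow> 2 / 9) (at_right 0)"
proof -
  have "((\<lambda>\<delta>. spin_weight (beta_c - \<delta>)) has_real_derivative 2 / 9) (at 0)"
    unfolding spin_weight_def by (auto intro!: derivative_eq_intros simp: beta_c_def)
  then have "((\<lambda>\<delta>. (spin_weight (beta_c - \<delta>) - 1 / 3) / \<delta>) \<longlongrightarrow> 2 / 9) (at 0)"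
    by (simp add: has_field_derivative_iff spin_weight_def beta_c_def)
  then show ?thesis by (rule tendsto_mono[OF at_le, rotated]) auto
qed

text \<open>\<open>K_curve \<beta>\<close> is the value of \<open>K\<close> at which the quadratic coefficient vanishes. The bracket has no
  term of order two.\<close>

lemma free_energy_split:
  assumes "0 < \<beta>"
  shows "free_energy \<beta> K x = 2 * \<beta>\<^sup>2 * K * spin_weight \<beta> * (K_curve \<beta> - K) * x\<^sup>2
    + (spin_weight \<beta> * (2 * \<beta> * K * x)\<^sup>2 / 2 - ln (1 + spin_weight \<beta> * (cosh (2 * \<beta> * K * x) - 1)))"
proof -
  have e: "0 < exp \<beta> + 2" by (simp add: add_pos_pos)
  have "2 * \<beta> * spin_weight \<beta> * K_curve \<beta> = 1"
    using assms e by (simp add: spin_weight_def K_curve_def)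
  then have "2 * \<beta>\<^sup>2 * K * spin_weight \<beta> * K_curve \<beta> = \<beta> * K"
    by (metis (no_types, opaque_lifting) mult.assoc mult.commute mult_1 power2_eq_square)
  then show ?thesis
    by (simp add: free_energy_def cumulant_eq right_diff_distrib left_diff_distrib power2_eq_square)
qed

lemma spin_weight_bounds:
  assumes "0 < \<beta>" "\<beta> \<le> beta_c"
  shows "1 / 3 \<le> spin_weight \<beta>" "spin_weight \<beta> \<le> 1"
proof -
  have "exp \<beta> \<le> 4" "0 < exp \<beta>" using assms(2) by (auto simp: beta_c_def ln_ge_iff)
  then show "1 / 3 \<le> spin_weight \<beta>" "spin_weight \<beta> \<le> 1"
    using add_pos_pos[of "exp \<beta>" 2] by (simp_all add: spin_weight_def le_divide_eq divide_le_eq)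
qed

lemma free_energy_lower:
  assumes "0 < \<beta>" "\<beta> \<le> beta_c"
  shows "2 * \<beta>\<^sup>2 * K * spin_weight \<beta> * (K_curve \<beta> - K) * x\<^sup>2
      + (spin_weight \<beta> - 1 / 3) * ((2 * \<beta> * K * x) ^ 4 / (2 * (12 + (2 * \<beta> * K * x)\<^sup>2)))
    \<le> free_energy \<beta> K x"
  using cumulant_upper[OF spin_weight_bounds(1)[OF assms], of "2 * \<beta> * K * x"]
  unfolding free_energy_split[OF assms(1)] by linarith

lemma free_energy_upper:
  assumes "0 < \<beta>" "\<beta> \<le> beta_c" "\<bar>2 * \<beta> * K * x\<bar> \<le> 1"
  shows "free_energy \<beta> K x \<le> 2 * \<beta>\<^sup>2 * K * spin_weight \<beta> * (K_curve \<beta> - K) * x\<^sup>2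
      + spin_weight \<beta> * (3 * spin_weight \<beta> - 1) * (2 * \<beta> * K * x) ^ 4 / 24 + (2 * \<beta> * K * x) ^ 6"
  using cumulant_lower[OF _ spin_weight_bounds(2)[OF assms(1,2)] assms(3)] spin_weight_bounds(1)[OF assms(1,2)]
  unfolding free_energy_split[OF assms(1)] by linarith
lemma free_energy_at_0: "free_energy \<beta> K 0 = 0"
  by (simp add: free_energy_def cumulant_eq)

lemma continuous_free_energy: "continuous_on S (free_energy \<beta> K)"
  using free_energy_has_derivative by (blast intro: continuous_at_imp_continuous_on DERIV_isCont)

section \<open>Uniqueness of the positive minimum point\<close>

text \<open>With \<open>a = exp \<beta>\<close> and \<open>c = cosh t\<close> this function is the second derivative of the cumulant. Its
  monotonicity in \<open>c\<close> for \<open>a \<le> 4\<close>, that is \<open>\<beta> \<le> beta_c\<close>, says that the mean-field magnetization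
  is a strictly concave function of the field \<open>t \<ge> 0\<close>.\<close>

lemma mean_field_slope_strict_decreasing:
  fixes a c d :: real
  assumes "0 < a" "a \<le> 4" "1 \<le> c" "c < d"
  shows "(2 * a * d + 4) / (a + 2 * d)\<^sup>2 < (2 * a * c + 4) / (a + 2 * c)\<^sup>2"
proof -
  have "a ^ 3 \<le> 16 * a"
    using mult_mono[OF assms(2,2)] assms(1) by (simp add: power3_eq_cube)
  moreover have "a * 1 \<le> a * (c * d)"
    using assms mult_mono[of 1 c 1 d] by (intro mult_left_mono) auto
  then have "8 * a \<le> 8 * (a * (c * d))" by simp
  moreover have "2 < c + d" using assms by simp
  then have "32 < 16 * (c + d)" by simp
  moreover have "8 * a \<le> 32" using assms by simp
  ultimately have "0 < 8 * (a * (c * d)) + 16 * a + 16 * (c + d) - 2 * a ^ 3" by linarith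
  then have "0 < (d - c) * (8 * (a * (c * d)) + 16 * a + 16 * (c + d) - 2 * a ^ 3)"
    using assms by (intro mult_pos_pos) auto
  also have "\<dots> = (2 * a * c + 4) * (a + 2 * d)\<^sup>2 - (2 * a * d + 4) * (a + 2 * c)\<^sup>2"
    by (simp add: power2_eq_square power3_eq_cube algebra_simps)
  finally have "(2 * a * d + 4) * (a + 2 * c)\<^sup>2 < (2 * a * c + 4) * (a + 2 * d)\<^sup>2" by simp
  moreover have "0 < (a + 2 * c)\<^sup>2" "0 < (a + 2 * d)\<^sup>2" using assms by auto
  ultimately show ?thesis by (simp add: frac_less_eq divide_less_0_iff)
qed

text \<open>Two positive critical points together with the critical point \<open>0\<close> would give, by Rolle's theorem,
  two positive fields at which the second derivative of the cumulant has the same value.\<close>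

lemma pos_global_min_unique:
  assumes \<beta>: "0 < \<beta>" "\<beta> \<le> beta_c" and K: "0 < K"
    and x: "0 < x" "x \<in> global_min_points (free_energy \<beta> K)"
    and y: "0 < y" "y \<in> global_min_points (free_energy \<beta> K)"
  shows "x = y"
proof -
  define k where "k = 2 * \<beta> * K"
  have k: "0 < k" using \<beta> K by (simp add: k_def)
  have a: "0 < exp \<beta>" "exp \<beta> \<le> 4"
    using \<beta>(2) by (auto simp: beta_c_def ln_ge_iff)
  \<comment> \<open>In the field variable \<open>t = k x\<close> critical points of the free energy are the zeros of \<open>\<phi>\<close>.\<close>
  define \<phi> where "\<phi> = (\<lambda>t. 2 * sinh t / (exp \<beta> + 2 * cosh t) - t / k)"
  have den: "0 < exp \<beta> + 2 * cosh t" for t :: real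
    by (intro add_pos_pos) auto
  have \<phi>': "(\<phi> has_real_derivative (2 * exp \<beta> * cosh t + 4) / (exp \<beta> + 2 * cosh t)\<^sup>2 - 1 / k) (at t)" for t
  proof -
    have "(\<phi> has_real_derivative (2 * cosh t * (exp \<beta> + 2 * cosh t) - 2 * sinh t * (2 * sinh t))
        / ((exp \<beta> + 2 * cosh t) * (exp \<beta> + 2 * cosh t)) - 1 / k) (at t)"
      unfolding \<phi>_def using den[of t] k by (auto intro!: derivative_eq_intros)
    moreover have "2 * cosh t * (exp \<beta> + 2 * cosh t) - 2 * sinh t * (2 * sinh t) = 2 * exp \<beta> * cosh t + 4"
      using cosh_square_eq[of t] by (simp add: power2_eq_square algebra_simps)
    ultimately show ?thesis by (simp add: power2_eq_square)
  qed
  have crit: "\<phi> (k * z) = 0" if "z \<in> global_min_points (free_energy \<beta> K)" for z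
  proof -
    have "2 * \<beta> * K * (z - 2 * sinh (2 * \<beta> * K * z) / (exp \<beta> + 2 * cosh (2 * \<beta> * K * z))) = 0"
      by (rule DERIV_local_min[OF free_energy_has_derivative, of 1]) (use that in \<open>auto simp: global_min_points_def\<close>)
    then have "z = 2 * sinh (k * z) / (exp \<beta> + 2 * cosh (k * z))"
      using \<beta>(1) K by (simp add: k_def)
    then show ?thesis using k by (simp add: \<phi>_def)
  qed
  have rolle: "\<exists>s>u. s < v \<and> (2 * exp \<beta> * cosh s + 4) / (exp \<beta> + 2 * cosh s)\<^sup>2 = 1 / k"
    if "u < v" "\<phi> u = 0" "\<phi> v = 0" for u v
  proof -
    have "\<exists>z. u < z \<and> z < v \<and> \<phi> v - \<phi> u
        = (v - u) * ((2 * exp \<beta> * cosh z + 4) / (exp \<beta> + 2 * cosh z)\<^sup>2 - 1 / k)"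
      by (rule MVT2[OF that(1)]) (rule \<phi>')
    then show ?thesis using that by auto
  qed
  have False if uv: "0 < u" "u < v" "u \<in> global_min_points (free_energy \<beta> K)"
     "v \<in> global_min_points (free_energy \<beta> K)" for u v
  proof -
    obtain s1 where s1: "0 < s1" "s1 < k * u"
        "(2 * exp \<beta> * cosh s1 + 4) / (exp \<beta> + 2 * cosh s1)\<^sup>2 = 1 / k"
      using rolle[of 0 "k * u"] crit[OF uv(3)] k uv(1) by (auto simp: \<phi>_def)
    obtain s2 where s2: "k * u < s2"
        "(2 * exp \<beta> * cosh s2 + 4) / (exp \<beta> + 2 * cosh s2)\<^sup>2 = 1 / k"
      using rolle[of "k * u" "k * v"] crit[OF uv(3)] crit[OF uv(4)] k uv(2) by auto
    have "cosh s1 < cosh s2" using s1 s2 by (subst cosh_real_nonneg_less_iff)  auto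
    then show False
      using mean_field_slope_strict_decreasing[OF a cosh_real_ge_1[of s1]] s1(3) s2(2) by force
  qed
  then show ?thesis using x y by (metis linorder_neqE_linordered_idom)
qed

section \<open>Scaling along the path to the tricritical point\<close>

lemma powr_sequence_at_top:
  assumes "0 < a"
  shows "filterlim (\<lambda>n. real n powr a) at_top sequentially"
proof -
  have "filterlim (\<lambda>n. inverse (real n powr - a)) at_top sequentially"
  proof (rule filterlim_inverse_at_top)
    show "(\<lambda>n. real n powr - a) \<longlonglongrightarrow> 0"
      using assms by (intro tendsto_neg_powr filterlim_real_sequentially) auto
    show "\<forall>\<^sub>F n in sequentially. 0 < real n powr - a"
      using eventually_gt_at_top[of 0] by eventually_elim simp
  qed
  then show ?thesis by (simp add: powr_minus)
qed

locale tricritical_path =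
  fixes p :: nat and l \<alpha> :: real
  assumes p: "3 \<le> p" and sign: "(K_deriv p - l) * (-1) ^ p < 0" and \<alpha>: "0 < \<alpha>"
begin

abbreviation "b \<equiv> beta_seq \<alpha>"
abbreviation "K \<equiv> K_seq p l \<alpha>"

text \<open>\<open>inv_dist n\<close> is the reciprocal of \<open>beta_c - b n\<close>, and \<open>1 / scale n\<close> is the order of
  magnitude of \<open>x\<close> at which the quadratic and the quartic term of the free energy balance.\<close>

definition inv_dist :: "nat \<Rightarrow> real" where "inv_dist n = real n powr \<alpha>"
definition scale :: "nat \<Rightarrow> real" where "scale n = real n powr ((real p - 1) * \<alpha> / 2)"
definition coupling :: "nat \<Rightarrow> real" where "coupling n = 2 * b n * K n"

text \<open>The prefactor is \<open>n powr ((2 p - 1) \<alpha>)\<close>, written in the form in which it combines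
  with powers of \<open>y / scale n\<close>: the quadratic term is left with
  \<open>inv_dist n * (scale n)\<^sup>2 = inv_dist n ^ p\<close> and the quartic one with \<open>inv_dist n\<close>.\<close>

definition scaled_energy :: "nat \<Rightarrow> real \<Rightarrow> real" where
  "scaled_energy n y = inv_dist n * scale n ^ 4 * free_energy (b n) (K n) (y / scale n)"

lemma inv_dist_pos: "0 < n \<Longrightarrow> 0 < inv_dist n" and scale_pos: "0 < n \<Longrightarrow> 0 < scale n"
  by (simp_all add: inv_dist_def scale_def)

lemma inv_dist_power: "0 < n \<Longrightarrow> inv_dist n ^ j = real n powr (real j * \<alpha>)"
  by (simp add: inv_dist_def powr_power)

lemma inv_dist_scale_square:
  assumes "0 < n"
  shows "inv_dist n * (scale n)\<^sup>2 = inv_dist n ^ p"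
proof -
  have "inv_dist n * (scale n)\<^sup>2 = real n powr (\<alpha> + (real p - 1) * \<alpha>)"
    using assms by (simp add: inv_dist_def scale_def powr_power powr_add)
  also have "\<alpha> + (real p - 1) * \<alpha> = real p * \<alpha>" by (simp add: algebra_simps)
  finally show ?thesis using inv_dist_power[OF assms] by simp
qed

lemma inv_dist_scale_fourth:
  assumes "0 < n"
  shows "inv_dist n * scale n ^ 4 = real n powr ((2 * real p - 1) * \<alpha>)"
proof -
  have "inv_dist n * scale n ^ 4 = real n powr (\<alpha> + 4 * ((real p - 1) * \<alpha> / 2))"
    using assms by (simp add: inv_dist_def scale_def powr_power powr_add)
  also have "\<alpha> + 4 * ((real p - 1) * \<alpha> / 2) = (2 * real p - 1) * \<alpha>" by (simp add: field_simps)
  finally show ?thesis .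
qed

lemma b_eq: "b n = beta_c - 1 / inv_dist n"
  by (simp add: beta_seq_def inv_dist_def)

lemma inverse_inv_dist_at_right: "filterlim (\<lambda>n. 1 / inv_dist n) (at_right 0) sequentially"
proof -
  have "(\<lambda>n. 1 / inv_dist n) \<longlonglongrightarrow> 0"
    using powr_sequence_at_top[OF \<alpha>] unfolding inv_dist_def
    by (intro tendsto_divide_0[OF tendsto_const] filterlim_at_top_imp_at_infinity)
  moreover have "\<forall>\<^sub>F n in sequentially. 1 / inv_dist n \<in> {0<..} \<and> 1 / inv_dist n \<noteq> 0"
    using eventually_gt_at_top[of 0] by eventually_elim (simp add: inv_dist_pos less_imp_neq[symmetric])
  ultimately show ?thesis by (simp add: filterlim_at)
qed

lemma b_tendsto: "b \<longlonglongrightarrow> beta_c"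
proof -
  have "(\<lambda>n. beta_c - 1 / inv_dist n) \<longlonglongrightarrow> beta_c - 0"
    using inverse_inv_dist_at_right by (intro tendsto_intros) (simp add: filterlim_at)
  then show ?thesis by (simp add: b_eq[abs_def])
qed

lemma K_seq_eq:
  assumes "0 < n"
  shows "K n = (\<Sum>j<p. K_deriv j * (- (1 / inv_dist n)) ^ j / fact j) + l * (-1) ^ p / fact p * (1 / inv_dist n) ^ p"
proof -
  obtain q where q: "p = Suc q" using p by (cases p) auto
  have "K_deriv j * (- (1 / inv_dist n)) ^ j / fact j
      = K_deriv j * (-1) ^ j / (fact j * real n powr (real j * \<alpha>))" for j
    unfolding inv_dist_power[OF assms, symmetric] by (subst power_minus) (simp add: power_divide)
  then have "(\<Sum>j<p. K_deriv j * (- (1 / inv_dist n)) ^ j / fact j)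
      = (\<Sum>j<Suc q. K_deriv j * (-1) ^ j / (fact j * real n powr (real j * \<alpha>)))"
    by (simp only: q)
  also have "\<dots> = K_curve beta_c + (\<Sum>j=1..q. K_deriv j * (-1) ^ j / (fact j * real n powr (real j * \<alpha>)))"
    using assms unfolding sum.lessThan_Suc_shift One_nat_def sum.atLeast1_atMost_eq by simp
  finally show ?thesis
    unfolding K_seq_def inv_dist_power[OF assms, symmetric] by (simp add: q power_divide)
qed

text \<open>The path and the critical curve have the same Taylor polynomial of order \<open>p - 1\<close> at
  \<open>beta_c\<close>; the limit compares their coefficients of order \<open>p\<close>.\<close>

lemma gap_tendsto:
  "(\<lambda>n. inv_dist n ^ p * (K_curve (b n) - K n)) \<longlonglongrightarrow> (K_deriv p - l) * (-1) ^ p / fact p"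
proof -
  have "(\<lambda>n. (K_curve (beta_c - 1 / inv_dist n) - (\<Sum>j<p. K_deriv j * (- (1 / inv_dist n)) ^ j / fact j)) / (1 / inv_dist n) ^ p
      - l * (-1) ^ p / fact p) \<longlonglongrightarrow> K_deriv p * (-1) ^ p / fact p - l * (-1) ^ p / fact p"
    using p by (intro tendsto_diff tendsto_const
        filterlim_compose[OF K_curve_taylor_peano inverse_inv_dist_at_right]) auto
  moreover have "\<forall>\<^sub>F n in sequentially. (K_curve (beta_c - 1 / inv_dist n)
      - (\<Sum>j<p. K_deriv j * (- (1 / inv_dist n)) ^ j / fact j)) / (1 / inv_dist n) ^ p - l * (-1) ^ p / fact p
      = inv_dist n ^ p * (K_curve (b n) - K n)"
    using eventually_gt_at_top[of 0]
  proof eventually_elim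
    case (elim n)
    show ?case using inv_dist_pos[OF elim]
      unfolding K_seq_eq[OF elim] b_eq by (simp add: power_divide algebra_simps)
  qed
  ultimately show ?thesis
    by (simp add: tendsto_cong left_diff_distrib diff_divide_distrib)
qed

lemma K_tendsto: "K \<longlonglongrightarrow> K_curve beta_c"
proof -
  have "(\<lambda>n. (1 / inv_dist n) ^ p) \<longlonglongrightarrow> 0 ^ p"
    using inverse_inv_dist_at_right by (intro tendsto_power) (simp add: filterlim_at)
  then have "(\<lambda>n. (1 / inv_dist n) ^ p * (inv_dist n ^ p * (K_curve (b n) - K n))) \<longlonglongrightarrow> 0"
    using tendsto_mult[OF _ gap_tendsto, of "\<lambda>n. (1 / inv_dist n) ^ p" 0] p by (simp add: power_0_left)
  moreover have "\<forall>\<^sub>F n in sequentially. (1 / inv_dist n) ^ p * (inv_dist n ^ p * (K_curve (b n) - K n)) = K_curve (b n) - K n"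
    using eventually_gt_at_top[of 0]
  proof eventually_elim
    case (elim n)
    then show ?case using inv_dist_pos[of n] by (simp add: power_divide)
  qed
  ultimately have "(\<lambda>n. K_curve (b n) - K n) \<longlonglongrightarrow> 0"
    by (simp add: tendsto_cong)
  moreover have "isCont K_curve beta_c"
    using K_curve_has_derivs[OF beta_c_pos, of 0] by (auto intro: DERIV_isCont)
  then have "(\<lambda>n. K_curve (b n)) \<longlonglongrightarrow> K_curve beta_c"
    by (rule isCont_tendsto_compose[OF _ b_tendsto])
  ultimately have "(\<lambda>n. K_curve (b n) - (K_curve (b n) - K n)) \<longlonglongrightarrow> K_curve beta_c - 0"
    by (intro tendsto_diff)
  then show ?thesis by simp
qed

lemma K_curve_beta_c: "beta_c * K_curve beta_c = 3 / 2"
  using beta_c_pos by (simp add: K_curve_def) (simp add: beta_c_def)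

lemma coupling_tendsto: "coupling \<longlonglongrightarrow> 3"
proof -
  have "coupling \<longlonglongrightarrow> 2 * beta_c * K_curve beta_c"
    unfolding coupling_def by (intro tendsto_intros b_tendsto K_tendsto)
  moreover have "2 * beta_c * K_curve beta_c = 3" using K_curve_beta_c by simp
  ultimately show ?thesis by simp
qed

lemma eventually_pos: "\<forall>\<^sub>F n in sequentially. 0 < n \<and> 0 < b n \<and> b n \<le> beta_c \<and> 0 < K n"
proof -
  have "0 < K_curve beta_c"
    unfolding K_curve_def using beta_c_pos by (intro divide_pos_pos add_pos_pos) auto
  then have "\<forall>\<^sub>F n in sequentially. 0 < K n" by (rule order_tendstoD(1)[OF K_tendsto])
  moreover have "\<forall>\<^sub>F n in sequentially. 0 < b n" by (rule order_tendstoD(1)[OF b_tendsto beta_c_pos])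
  ultimately show ?thesis using eventually_gt_at_top[of 0]
  proof eventually_elim
    case (elim n)
    then have "b n \<le> beta_c" using inv_dist_pos[of n] by (simp add: b_eq)
    with elim show ?case by simp
  qed
qed

lemma spin_weight_tendsto: "(\<lambda>n. spin_weight (b n)) \<longlonglongrightarrow> 1 / 3"
proof -
  have "(\<lambda>n. spin_weight (b n)) \<longlonglongrightarrow> 2 / (exp beta_c + 2)"
    unfolding spin_weight_def by (intro tendsto_intros b_tendsto) (simp add: beta_c_def)
  then show ?thesis by (simp add: beta_c_def)
qed

lemma excess_weight_tendsto: "(\<lambda>n. inv_dist n * (spin_weight (b n) - 1 / 3)) \<longlonglongrightarrow> 2 / 9"
proof -
  have "(\<lambda>n. (spin_weight (beta_c - 1 / inv_dist n) - 1 / 3) / (1 / inv_dist n)) \<longlonglongrightarrow> 2 / 9"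
    by (rule filterlim_compose[OF spin_weight_limit inverse_inv_dist_at_right])
  then show ?thesis by (simp add: b_eq mult.commute)
qed

lemma inverse_scale_square_tendsto: "(\<lambda>n. 1 / (scale n)\<^sup>2) \<longlonglongrightarrow> 0"
proof -
  have "0 < (real p - 1) * \<alpha> / 2" using p \<alpha> by simp
  from powr_sequence_at_top[OF this] have "(\<lambda>n. 1 / scale n) \<longlonglongrightarrow> 0"
    unfolding scale_def by (intro tendsto_divide_0[OF tendsto_const] filterlim_at_top_imp_at_infinity)
  from tendsto_power[OF this, of 2] show ?thesis by (simp add: power_divide)
qed

text \<open>The order of the sextic remainder is \<open>n powr (- (p - 2) \<alpha>)\<close>, which tends to zero because
  \<open>p > 2\<close>.\<close>

lemma inv_dist_over_scale_square_tendsto: "(\<lambda>n. inv_dist n / (scale n)\<^sup>2) \<longlonglongrightarrow> 0"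
proof -
  have "\<forall>\<^sub>F n in sequentially. real n powr (- ((real p - 2) * \<alpha>)) = inv_dist n / (scale n)\<^sup>2"
    using eventually_gt_at_top[of 0]
  proof eventually_elim
    case (elim n)
    have "(scale n)\<^sup>2 = real n powr ((real p - 1) * \<alpha>)" using elim by (simp add: scale_def powr_power)
    then show ?case by (simp add: inv_dist_def algebra_simps flip: powr_diff)
  qed
  moreover have "(\<lambda>n. real n powr (- ((real p - 2) * \<alpha>))) \<longlonglongrightarrow> 0"
    using p \<alpha> by (intro tendsto_neg_powr filterlim_real_sequentially) auto
  ultimately show ?thesis by (simp add: tendsto_cong)
qed

text \<open>\<open>quad_coeff\<close> and \<open>quart_coeff\<close> are the coefficients with which
  \<open>free_energy_lower\<close> bounds \<open>scaled_energy\<close> from below.\<close>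

definition quad_coeff :: "nat \<Rightarrow> real" where
  "quad_coeff n = coupling n * b n * spin_weight (b n) * (inv_dist n ^ p * (K_curve (b n) - K n))"
definition quart_coeff :: "nat \<Rightarrow> real" where
  "quart_coeff n = inv_dist n * (spin_weight (b n) - 1 / 3) * coupling n ^ 4 / 24"

abbreviation "gl_quad \<equiv> 1 / fact p * beta_c * (K_deriv p - l) * (-1) ^ p"

lemma quad_coeff_tendsto: "quad_coeff \<longlonglongrightarrow> gl_quad"
proof -
  have "quad_coeff \<longlonglongrightarrow> 3 * beta_c * (1 / 3) * ((K_deriv p - l) * (-1) ^ p / fact p)"
    unfolding quad_coeff_def by (intro tendsto_mult coupling_tendsto b_tendsto spin_weight_tendsto gap_tendsto)
  then show ?thesis by (simp add: mult_ac)
qed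

lemma quart_coeff_tendsto: "quart_coeff \<longlonglongrightarrow> 3 / 4"
proof -
  have "quart_coeff \<longlonglongrightarrow> 2 / 9 * 3 ^ 4 / 24"
    unfolding quart_coeff_def by (intro tendsto_intros excess_weight_tendsto coupling_tendsto) auto
  then show ?thesis by simp
qed

lemma scaled_energy_lower:
  assumes n: "0 < n" "0 < b n" "b n \<le> beta_c"
  shows "quad_coeff n * y\<^sup>2 + quart_coeff n * (y ^ 4 / (1 + (coupling n)\<^sup>2 / 12 * (1 / (scale n)\<^sup>2) * y\<^sup>2)) \<le> scaled_energy n y"
proof -
  have s: "0 < scale n" "0 < inv_dist n" using scale_pos[OF n(1)] inv_dist_pos[OF n(1)] by simp_all
  have "2 * (b n)\<^sup>2 * K n * spin_weight (b n) * (K_curve (b n) - K n) * (y / scale n)\<^sup>2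
      + (spin_weight (b n) - 1 / 3) * ((2 * b n * K n * (y / scale n)) ^ 4 / (2 * (12 + (2 * b n * K n * (y / scale n))\<^sup>2)))
      \<le> free_energy (b n) (K n) (y / scale n)"
    by (rule free_energy_lower[OF n(2,3)])
  then have "inv_dist n * scale n ^ 4 * (2 * (b n)\<^sup>2 * K n * spin_weight (b n) * (K_curve (b n) - K n) * (y / scale n)\<^sup>2
      + (spin_weight (b n) - 1 / 3) * ((coupling n * (y / scale n)) ^ 4 / (2 * (12 + (coupling n * (y / scale n))\<^sup>2))))
      \<le> scaled_energy n y"
    unfolding scaled_energy_def coupling_def[symmetric] using s by (intro mult_left_mono) auto
  moreover have "inv_dist n * scale n ^ 4 * (2 * (b n)\<^sup>2 * K n * spin_weight (b n) * (K_curve (b n) - K n) * (y / scale n)\<^sup>2)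
      = quad_coeff n * y\<^sup>2"
    unfolding quad_coeff_def inv_dist_scale_square[OF n(1), symmetric] coupling_def using s
    by (simp add: field_simps power2_eq_square eval_nat_numeral)
  moreover have "inv_dist n * scale n ^ 4 * ((spin_weight (b n) - 1 / 3)
        * ((coupling n * (y / scale n)) ^ 4 / (2 * (12 + (coupling n * (y / scale n))\<^sup>2))))
      = quart_coeff n * (y ^ 4 / (1 + (coupling n)\<^sup>2 / 12 * (1 / (scale n)\<^sup>2) * y\<^sup>2))"
  proof -
    have "2 * (12 + (coupling n * (y / scale n))\<^sup>2) = 24 * (1 + (coupling n)\<^sup>2 / 12 * (1 / (scale n)\<^sup>2) * y\<^sup>2)"
      by (simp add: power_mult_distrib power_divide)
    moreover have "scale n ^ 4 * (coupling n * (y / scale n)) ^ 4 = coupling n ^ 4 * y ^ 4"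
      using s by (simp add: power_mult_distrib power_divide)
    ultimately show ?thesis unfolding quart_coeff_def by (simp add: mult_ac)
  qed
  ultimately show ?thesis by (simp only: distrib_left)
qed

lemma scaled_energy_upper:
  assumes n: "0 < n" "0 < b n" "b n \<le> beta_c" and y: "\<bar>coupling n * (y / scale n)\<bar> \<le> 1"
  shows "scaled_energy n y \<le> quad_coeff n * y\<^sup>2 + 3 * spin_weight (b n) * quart_coeff n * y ^ 4 + coupling n ^ 6 * (inv_dist n / (scale n)\<^sup>2) * y ^ 6"
proof -
  have s: "0 < scale n" "0 < inv_dist n" using scale_pos[OF n(1)] inv_dist_pos[OF n(1)] by simp_all
  have "free_energy (b n) (K n) (y / scale n)
     \<le> 2 * (b n)\<^sup>2 * K n * spin_weight (b n) * (K_curve (b n) - K n) * (y / scale n)\<^sup>2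
      + spin_weight (b n) * (3 * spin_weight (b n) - 1) * (coupling n * (y / scale n)) ^ 4 / 24 + (coupling n * (y / scale n)) ^ 6"
    using free_energy_upper[OF n(2,3), of "K n" "y / scale n"] y by (simp only: coupling_def)
  then have "scaled_energy n y \<le> inv_dist n * scale n ^ 4 * (2 * (b n)\<^sup>2 * K n * spin_weight (b n) * (K_curve (b n) - K n) * (y / scale n)\<^sup>2
      + spin_weight (b n) * (3 * spin_weight (b n) - 1) * (coupling n * (y / scale n)) ^ 4 / 24 + (coupling n * (y / scale n)) ^ 6)"
    unfolding scaled_energy_def using s by (intro mult_left_mono) auto
  moreover have "inv_dist n * scale n ^ 4 * (2 * (b n)\<^sup>2 * K n * spin_weight (b n) * (K_curve (b n) - K n) * (y / scale n)\<^sup>2)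
      = quad_coeff n * y\<^sup>2"
    unfolding quad_coeff_def inv_dist_scale_square[OF n(1), symmetric] coupling_def using s
    by (simp add: field_simps power2_eq_square eval_nat_numeral)
  moreover have "inv_dist n * scale n ^ 4 * (spin_weight (b n) * (3 * spin_weight (b n) - 1) * (coupling n * (y / scale n)) ^ 4 / 24)
      = 3 * spin_weight (b n) * quart_coeff n * y ^ 4"
  proof -
    have *: "scale n ^ 4 * (coupling n * (y / scale n)) ^ 4 = coupling n ^ 4 * y ^ 4"
      using s by (simp add: power_mult_distrib power_divide)
    have "inv_dist n * scale n ^ 4 * (spin_weight (b n) * (3 * spin_weight (b n) - 1) * (coupling n * (y / scale n)) ^ 4 / 24)
      = inv_dist n * (spin_weight (b n) * (3 * spin_weight (b n) - 1)) * (scale n ^ 4 * (coupling n * (y / scale n)) ^ 4) / 24"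
      by (simp add: mult_ac)
    also have "\<dots> = 3 * spin_weight (b n) * quart_coeff n * y ^ 4"
      unfolding * quart_coeff_def by (simp add: field_simps)
    finally show ?thesis .
  qed
  moreover have "inv_dist n * scale n ^ 4 * (coupling n * (y / scale n)) ^ 6 = coupling n ^ 6 * (inv_dist n / (scale n)\<^sup>2) * y ^ 6"
    using s by (simp add: power_mult_distrib power_divide field_simps eval_nat_numeral)
  ultimately show ?thesis by (simp only: distrib_left)
qed

lemma damping_tendsto: "(\<lambda>n. (coupling n)\<^sup>2 / 12 * (1 / (scale n)\<^sup>2)) \<longlonglongrightarrow> 0"
proof -
  have "(\<lambda>n. (coupling n)\<^sup>2 / 12 * (1 / (scale n)\<^sup>2)) \<longlonglongrightarrow> 3\<^sup>2 / 12 * 0"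
    by (intro tendsto_intros coupling_tendsto inverse_scale_square_tendsto) auto
  then show ?thesis by simp
qed

lemma scaled_energy_eventually_lower:
  "\<forall>\<^sub>F n in sequentially. 0 \<le> quart_coeff n \<and> 0 \<le> (coupling n)\<^sup>2 / 12 * (1 / (scale n)\<^sup>2) \<and>
      (\<forall>y. quad_coeff n * y\<^sup>2 + quart_coeff n * (y ^ 4 / (1 + (coupling n)\<^sup>2 / 12 * (1 / (scale n)\<^sup>2) * y\<^sup>2)) \<le> scaled_energy n y)"
  using eventually_pos order_tendstoD(1)[OF quart_coeff_tendsto, of 0, simplified]
  by eventually_elim (use scaled_energy_lower in auto)

lemma scaled_energy_coercive: "\<exists>C. \<forall>\<^sub>F n in sequentially. \<forall>y. y\<^sup>2 - C \<le> scaled_energy n y"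
  by (rule coercive_quartic_sandwich[OF quad_coeff_tendsto quart_coeff_tendsto damping_tendsto _ scaled_energy_eventually_lower]) simp

lemma gl_poly_eq: "gl_poly p l = (\<lambda>y. gl_quad * y\<^sup>2 + 3 / 4 * y ^ 4)"
  by (simp add: fun_eq_iff gl_poly_def c4_def)

lemma scaled_energy_uniform_limit: "uniform_limit {-R..R} scaled_energy (gl_poly p l) sequentially"
  unfolding gl_poly_eq
proof (rule uniform_limit_quartic_sandwich[OF quad_coeff_tendsto quart_coeff_tendsto _ damping_tendsto _ scaled_energy_eventually_lower])
  have "(\<lambda>n. 3 * spin_weight (b n) * quart_coeff n) \<longlonglongrightarrow> 3 * (1 / 3) * (3 / 4)"
    by (intro tendsto_intros spin_weight_tendsto quart_coeff_tendsto)
  then show "(\<lambda>n. 3 * spin_weight (b n) * quart_coeff n) \<longlonglongrightarrow> 3 / 4" by simp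
  have "(\<lambda>n. coupling n ^ 6 * (inv_dist n / (scale n)\<^sup>2)) \<longlonglongrightarrow> 3 ^ 6 * 0"
    by (intro tendsto_intros coupling_tendsto inv_dist_over_scale_square_tendsto)
  then show "(\<lambda>n. coupling n ^ 6 * (inv_dist n / (scale n)\<^sup>2)) \<longlonglongrightarrow> 0" by simp
  fix R :: real
  have "(\<lambda>n. (coupling n)\<^sup>2 / 12 * (1 / (scale n)\<^sup>2) * (12 * R\<^sup>2)) \<longlonglongrightarrow> 0 * (12 * R\<^sup>2)"
    by (intro tendsto_mult damping_tendsto tendsto_const)
  then have "\<forall>\<^sub>F n in sequentially. (coupling n)\<^sup>2 / 12 * (1 / (scale n)\<^sup>2) * (12 * R\<^sup>2) < 1"
    by (intro order_tendstoD(2)) auto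
  with eventually_pos show "\<forall>\<^sub>F n in sequentially. \<forall>y. \<bar>y\<bar> \<le> R \<longrightarrow> scaled_energy n y \<le> quad_coeff n * y\<^sup>2
      + 3 * spin_weight (b n) * quart_coeff n * y ^ 4 + coupling n ^ 6 * (inv_dist n / (scale n)\<^sup>2) * y ^ 6"
  proof eventually_elim
    case (elim n)
    show ?case
    proof (intro allI impI)
      fix y assume y: "\<bar>y\<bar> \<le> R"
      have "(coupling n * (y / scale n))\<^sup>2 = ((coupling n)\<^sup>2 * (1 / (scale n)\<^sup>2)) * \<bar>y\<bar>\<^sup>2"
        by (simp add: power_mult_distrib power_divide)
      also have "\<dots> \<le> ((coupling n)\<^sup>2 * (1 / (scale n)\<^sup>2)) * R\<^sup>2"
        using y by (intro mult_left_mono power_mono) auto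
      also have "\<dots> \<le> 1" using elim by simp
      finally have "\<bar>coupling n * (y / scale n)\<bar> \<le> 1" by (simp add: abs_square_le_1)
      then show "scaled_energy n y \<le> quad_coeff n * y\<^sup>2 + 3 * spin_weight (b n) * quart_coeff n * y ^ 4 + coupling n ^ 6 * (inv_dist n / (scale n)\<^sup>2) * y ^ 6"
        using elim by (intro scaled_energy_upper) auto
    qed
  qed
qed

lemma gl_quad_neg: "gl_quad < 0"
proof -
  have "0 < 1 / fact p * beta_c" using beta_c_pos by simp
  from mult_pos_neg[OF this sign] show ?thesis by (simp add: mult.assoc)
qed

lemma x_bar_eq: "x_bar p l = sqrt (- gl_quad / (2 * (3 / 4)))"
  unfolding x_bar_def gl_poly_eq by (rule double_well_pos_min_point[OF gl_quad_neg]) simp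

lemma x_bar_pos: "0 < x_bar p l"
  unfolding x_bar_eq by (rule double_well_min_pos[OF gl_quad_neg]) simp

lemma gl_poly_separated:
  "0 < \<epsilon> \<Longrightarrow> \<exists>\<eta>>0. \<forall>y. \<epsilon> \<le> \<bar>\<bar>y\<bar> - x_bar p l\<bar> \<longrightarrow> gl_poly p l (x_bar p l) + \<eta> \<le> gl_poly p l y"
  unfolding x_bar_eq gl_poly_eq by (rule double_well_separated[OF gl_quad_neg]) simp

lemma gl_poly_x_bar_neg: "gl_poly p l (x_bar p l) < 0"
proof -
  obtain \<eta> where \<eta>: "0 < \<eta>"
    "\<And>y. x_bar p l \<le> \<bar>\<bar>y\<bar> - x_bar p l\<bar> \<Longrightarrow> gl_poly p l (x_bar p l) + \<eta> \<le> gl_poly p l y"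
    using gl_poly_separated[OF x_bar_pos] by blast
  have "gl_poly p l (x_bar p l) + \<eta> \<le> gl_poly p l 0" by (rule \<eta>(2)) simp
  moreover have "gl_poly p l 0 = 0" by (simp add: gl_poly_def)
  ultimately show ?thesis using \<eta>(1) by linarith
qed

lemma scaled_energy_tendsto: "(\<lambda>n. scaled_energy n y) \<longlonglongrightarrow> gl_poly p l y"
  by (rule tendsto_uniform_limitI[OF scaled_energy_uniform_limit[of "\<bar>y\<bar>"]]) auto

lemma continuous_scaled_energy: "continuous_on UNIV (scaled_energy n)"
proof -
  have "continuous_on UNIV (\<lambda>y. inv_dist n * scale n ^ 4 * free_energy (b n) (K n) (y * (1 / scale n)))"
    by (intro continuous_intros continuous_on_compose2[OF continuous_free_energy[of UNIV]]) auto
  then show ?thesis by (simp add: scaled_energy_def[abs_def])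
qed

lemma measurable_scaled_energy [measurable]: "scaled_energy n \<in> borel_measurable borel"
  using continuous_scaled_energy by (rule borel_measurable_continuous_onI)

text \<open>A minimum point exists by coercivity. It is not \<open>0\<close>, since the scaled energy vanishes there but is
  eventually negative at \<open>x_bar p l\<close>; evenness makes it positive, and uniqueness identifies it with
  the magnetization.\<close>

lemma magnetization_is_min:
  "\<forall>\<^sub>F n in sequentially. 0 < magnetization (b n) (K n)
     \<and> magnetization (b n) (K n) \<in> global_min_points (free_energy (b n) (K n))"
proof -
  obtain C where C: "\<forall>\<^sub>F n in sequentially. \<forall>y. y\<^sup>2 - C \<le> scaled_energy n y" using scaled_energy_coercive by blast
  have "\<forall>\<^sub>F n in sequentially. scaled_energy n (x_bar p l) < 0"
    by (rule order_tendstoD(2)[OF scaled_energy_tendsto gl_poly_x_bar_neg])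
  with C eventually_pos show ?thesis
  proof eventually_elim
    case (elim n)
    let ?G = "free_energy (b n) (K n)"
    have s: "0 < scale n" "0 < inv_dist n" using scale_pos[of n] inv_dist_pos[of n] elim by auto
    obtain z where z: "z \<in> global_min_points (scaled_energy n)"
      using coercive_attains_min[OF continuous_scaled_energy, of C n] elim by blast
    then have "scaled_energy n z < scaled_energy n 0"
      using elim by (auto simp: global_min_points_def scaled_energy_def free_energy_at_0 intro: le_less_trans)
    then have z0: "z \<noteq> 0" by auto
    define u where "u = \<bar>z\<bar> / scale n"
    have "?G u = ?G (z / scale n)"
      using s free_energy_even[of "b n" "K n" "z / scale n"] by (simp add: u_def abs_if)
    moreover have "?G (z / scale n) \<le> ?G x" for x
    proof -
      have "scaled_energy n z \<le> scaled_energy n (scale n * x)" using z by (simp add: global_min_points_def)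
      then show ?thesis using s by (simp add: scaled_energy_def)
    qed
    ultimately have u: "0 < u \<and> u \<in> global_min_points ?G"
      using z0 s by (simp add: u_def global_min_points_def)
    show ?case
      unfolding magnetization_def pos_min_point_def
    proof (rule theI[where a = u])
      fix x assume "0 < x \<and> x \<in> global_min_points ?G"
      then show "x = u" using u elim by (intro pos_global_min_unique[of "b n" "K n"]) auto
    qed (rule u)
  qed
qed

lemma magnetization_tendsto: "(\<lambda>n. scale n * magnetization (b n) (K n)) \<longlonglongrightarrow> x_bar p l"
proof -
  obtain C where C: "\<forall>\<^sub>F n in sequentially. \<forall>y. y\<^sup>2 - C \<le> scaled_energy n y" using scaled_energy_coercive by blast
  show ?thesis
  proof (rule minimizers_converge[OF C scaled_energy_uniform_limit gl_poly_separated])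
    show "\<forall>\<^sub>F n in sequentially. 0 \<le> scale n * magnetization (b n) (K n)
        \<and> scaled_energy n (scale n * magnetization (b n) (K n)) \<le> scaled_energy n (x_bar p l)"
      using magnetization_is_min eventually_gt_at_top[of 0]
    proof eventually_elim
      case (elim n)
      then have "0 < scale n" "0 < inv_dist n" using scale_pos[of n] inv_dist_pos[of n] by auto
      with elim show ?case
        by (auto simp: scaled_energy_def global_min_points_def intro!: mult_left_mono)
    qed
  qed
qed

lemma magnetization_asymp:
  "(\<lambda>n. magnetization (b n) (K n)) \<sim>[sequentially] (\<lambda>n. x_bar p l / scale n)"
proof (rule asymp_equivI')
  have "(\<lambda>n. scale n * magnetization (b n) (K n) / x_bar p l) \<longlonglongrightarrow> x_bar p l / x_bar p l"
    using x_bar_pos by (intro tendsto_divide magnetization_tendsto) auto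
  then show "(\<lambda>n. magnetization (b n) (K n) / (x_bar p l / scale n)) \<longlonglongrightarrow> 1"
    using x_bar_pos by (simp add: mult.commute)
qed

text \<open>In the variable \<open>y = scale n * x\<close> the exponent \<open>n free_energy\<close> becomes
  \<open>eff_size n * scaled_energy n y\<close>. The threshold \<open>\<alpha> = 1 / (2 p - 1)\<close> is where
  this factor stops growing.\<close>

definition eff_size :: "nat \<Rightarrow> real" where
  "eff_size n = real n powr (1 - (2 * real p - 1) * \<alpha>)"

lemma gibbs_exponent:
  assumes "0 < n"
  shows "real n * free_energy (b n) (K n) (y / scale n) = eff_size n * scaled_energy n y"
proof -
  have "eff_size n * (inv_dist n * scale n ^ 4) = real n"
    using assms unfolding inv_dist_scale_fourth[OF assms] by (simp add: eff_size_def flip: powr_add)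
  then show ?thesis unfolding scaled_energy_def by (metis mult.assoc)
qed

lemma rescaled_gibbs_mean:
  assumes n: "0 < n"
  shows "scale n * ((\<integral>x. \<bar>x\<bar> * exp (- (real n * free_energy (b n) (K n) x)) \<partial>lborel)
      / (\<integral>x. exp (- (real n * free_energy (b n) (K n) x)) \<partial>lborel))
    = (\<integral>y. \<bar>y\<bar> * exp (- (eff_size n * scaled_energy n y)) \<partial>lborel) / (\<integral>y. exp (- (eff_size n * scaled_energy n y)) \<partial>lborel)"
proof -
  have s: "0 < scale n" by (rule scale_pos[OF n])
  have "(\<integral>x. \<bar>x\<bar> * exp (- (real n * free_energy (b n) (K n) x)) \<partial>lborel)
      = 1 / scale n * (\<integral>y. \<bar>y / scale n\<bar> * exp (- (eff_size n * scaled_energy n y)) \<partial>lborel)"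
    using s lborel_integral_real_affine[of "1 / scale n"
        "\<lambda>x. \<bar>x\<bar> * exp (- (real n * free_energy (b n) (K n) x))" 0]
    by (simp add: gibbs_exponent[OF n])
  also have "(\<integral>y. \<bar>y / scale n\<bar> * exp (- (eff_size n * scaled_energy n y)) \<partial>lborel)
      = 1 / scale n * (\<integral>y. \<bar>y\<bar> * exp (- (eff_size n * scaled_energy n y)) \<partial>lborel)"
    using s by simp
  finally have 1: "(\<integral>x. \<bar>x\<bar> * exp (- (real n * free_energy (b n) (K n) x)) \<partial>lborel)
      = 1 / scale n * (1 / scale n * (\<integral>y. \<bar>y\<bar> * exp (- (eff_size n * scaled_energy n y)) \<partial>lborel))" .
  have 2: "(\<integral>x. exp (- (real n * free_energy (b n) (K n) x)) \<partial>lborel)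
      = 1 / scale n * (\<integral>y. exp (- (eff_size n * scaled_energy n y)) \<partial>lborel)"
    using s lborel_integral_real_affine[of "1 / scale n"
        "\<lambda>x. exp (- (real n * free_energy (b n) (K n) x))" 0]
    by (simp add: gibbs_exponent[OF n])
  show ?thesis unfolding 1 2 using s by simp
qed

text \<open>The Gaussian correction is of order \<open>1 / sqrt n\<close>, while \<open>scale n\<close> grows more slowly than
  \<open>sqrt n\<close> because \<open>(p - 1) \<alpha> < (2 p - 1) \<alpha> \<le> 1\<close>.\<close>

lemma smoothing_negligible:
  assumes "(2 * real p - 1) * \<alpha> \<le> 1"
  shows "(\<lambda>n. scale n * (1 / sqrt (pi * (real n * b n * K n)))) \<longlonglongrightarrow> 0"
proof -
  have "(real p - 1) * \<alpha> < (2 * real p - 1) * \<alpha>" using p \<alpha> by (intro mult_strict_right_mono) auto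
  then have "(\<lambda>n. real n powr ((real p - 1) * \<alpha> / 2 - 1 / 2)) \<longlonglongrightarrow> 0"
    using assms by (intro tendsto_neg_powr filterlim_real_sequentially) auto
  moreover have "(\<lambda>n. 1 / sqrt (pi * (b n * K n))) \<longlonglongrightarrow> 1 / sqrt (pi * (3 / 2))"
    unfolding K_curve_beta_c[symmetric]
    by (intro tendsto_intros b_tendsto K_tendsto) (simp add: K_curve_beta_c)
  ultimately have "(\<lambda>n. real n powr ((real p - 1) * \<alpha> / 2 - 1 / 2) * (1 / sqrt (pi * (b n * K n))))
      \<longlonglongrightarrow> 0 * (1 / sqrt (pi * (3 / 2)))"
    by (rule tendsto_mult)
  moreover have "real n powr ((real p - 1) * \<alpha> / 2 - 1 / 2) * (1 / sqrt (pi * (b n * K n)))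
      = scale n * (1 / sqrt (pi * (real n * b n * K n)))" for n
    by (simp add: scale_def powr_diff powr_half_sqrt real_sqrt_mult)
  ultimately show ?thesis by simp
qed

lemma mean_abs_spin_tendsto:
  assumes "(2 * real p - 1) * \<alpha> \<le> 1"
    and lim: "(\<lambda>n. (\<integral>y. \<bar>y\<bar> * exp (- (eff_size n * scaled_energy n y)) \<partial>lborel)
        / (\<integral>y. exp (- (eff_size n * scaled_energy n y)) \<partial>lborel)) \<longlonglongrightarrow> L"
  shows "(\<lambda>n. scale n * mean_abs_spin n (b n) (K n)) \<longlonglongrightarrow> L"
proof -
  let ?R = "\<lambda>n. (\<integral>y. \<bar>y\<bar> * exp (- (eff_size n * scaled_energy n y)) \<partial>lborel) / (\<integral>y. exp (- (eff_size n * scaled_energy n y)) \<partial>lborel)"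
  have "(\<lambda>n. scale n * mean_abs_spin n (b n) (K n) - ?R n) \<longlonglongrightarrow> 0"
  proof (rule Lim_null_comparison[OF _ smoothing_negligible[OF assms(1)]])
    show "\<forall>\<^sub>F n in sequentially. norm (scale n * mean_abs_spin n (b n) (K n) - ?R n)
        \<le> scale n * (1 / sqrt (pi * (real n * b n * K n)))"
      using eventually_pos
    proof eventually_elim
      case (elim n)
      then have n: "0 < n" "0 < b n" "0 < K n" by auto
      have s: "0 < scale n" by (rule scale_pos[OF n(1)])
      show ?case
        unfolding rescaled_gibbs_mean[OF n(1), symmetric] right_diff_distrib[symmetric] real_norm_def abs_mult
        using mult_left_mono[OF mean_abs_spin_smoothed[OF n], of "scale n"] s by simp
    qed
  qed
  from tendsto_add[OF this lim] show ?thesis by simp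
qed

lemma isCont_gl_poly: "isCont (gl_poly p l) y"
  unfolding gl_poly_eq by (intro continuous_intros)

lemma mean_abs_spin_subcritical:
  assumes "(2 * real p - 1) * \<alpha> < 1"
  shows "(\<lambda>n. scale n * mean_abs_spin n (b n) (K n)) \<longlonglongrightarrow> x_bar p l"
proof -
  obtain C where C: "\<forall>\<^sub>F n in sequentially. \<forall>y. y\<^sup>2 - C \<le> scaled_energy n y" using scaled_energy_coercive by blast
  have "filterlim eff_size at_top sequentially"
    unfolding eff_size_def using assms by (intro powr_sequence_at_top) simp
  then show ?thesis
    using assms by (intro mean_abs_spin_tendsto
        gibbs_abs_mean_concentrates[OF C scaled_energy_uniform_limit gl_poly_separated measurable_scaled_energy isCont_gl_poly]) auto
qed

lemma mean_abs_spin_critical: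
  assumes "(2 * real p - 1) * \<alpha> = 1"
  shows "(\<lambda>n. scale n * mean_abs_spin n (b n) (K n)) \<longlonglongrightarrow> z_bar p l"
proof -
  obtain C where C: "\<forall>\<^sub>F n in sequentially. \<forall>y. y\<^sup>2 - C \<le> scaled_energy n y" using scaled_energy_coercive by blast
  have "\<forall>\<^sub>F n in sequentially. (\<integral>y. \<bar>y\<bar> * exp (- scaled_energy n y) \<partial>lborel) / (\<integral>y. exp (- scaled_energy n y) \<partial>lborel)
      = (\<integral>y. \<bar>y\<bar> * exp (- (eff_size n * scaled_energy n y)) \<partial>lborel) / (\<integral>y. exp (- (eff_size n * scaled_energy n y)) \<partial>lborel)"
    using eventually_gt_at_top[of 0] by eventually_elim (simp add: eff_size_def assms)
  from tendsto_cong[OF this] gibbs_abs_mean_converges[OF C scaled_energy_tendsto measurable_scaled_energy] show ?thesis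
    using assms by (intro mean_abs_spin_tendsto) (auto simp: z_bar_def)
qed

lemma z_bar_pos: "0 < z_bar p l"
proof -
  obtain C where C: "\<forall>\<^sub>F n in sequentially. \<forall>y. y\<^sup>2 - C \<le> scaled_energy n y" using scaled_energy_coercive by blast
  have g: "y\<^sup>2 - C \<le> gl_poly p l y" for y
    using C by (intro tendsto_lowerbound[OF scaled_energy_tendsto]) (auto elim: eventually_mono)
  have m: "gl_poly p l \<in> borel_measurable borel"
    using isCont_gl_poly by (intro borel_measurable_continuous_onI continuous_at_imp_continuous_on) auto
  show ?thesis
    unfolding z_bar_def
    by (intro divide_pos_pos integral_pos_off_zero integrable_exp_minus[OF m g]
        integrable_abs_exp_minus[OF m g]) auto
qed

lemma asymp_of_scaled_limit:
  assumes "(\<lambda>n. scale n * f n) \<longlonglongrightarrow> c" "c \<noteq> 0"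
  shows "f \<sim>[sequentially] (\<lambda>n. c / scale n)"
proof (rule asymp_equivI')
  have "(\<lambda>n. scale n * f n / c) \<longlonglongrightarrow> c / c" using assms by (intro tendsto_divide) auto
  then show "(\<lambda>n. f n / (c / scale n)) \<longlonglongrightarrow> 1" using assms(2) by (simp add: mult.commute)
qed

end

section \<open>The asymptotic relations\<close>

theorem theorem5p6:
  fixes p :: nat and l :: real
  assumes "p \<ge> 3"
    and "l \<noteq> K_deriv p"
    and "(K_deriv p - l) * (-1) ^ p < 0"
  shows
    "(\<forall>\<alpha>>0.
        (\<lambda>n. magnetization (beta_seq \<alpha> n) (K_seq p l \<alpha> n))
          \<sim>[sequentially] (\<lambda>n. x_bar p l / real n powr ((real p - 1) * \<alpha> / 2))
        \<and> (\<forall>n\<ge>1. x_bar p l / real n powr ((real p - 1) * \<alpha> / 2)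
                 = x_bar p l * (beta_c - beta_seq \<alpha> n) powr ((real p - 1) / 2)))
     \<and> (\<forall>\<alpha>. 0 < \<alpha> \<and> \<alpha> < 1 / (2 * real p - 1) \<longrightarrow>
        (\<lambda>n. mean_abs_spin n (beta_seq \<alpha> n) (K_seq p l \<alpha> n))
          \<sim>[sequentially] (\<lambda>n. x_bar p l / real n powr ((real p - 1) * \<alpha> / 2))
        \<and> (\<lambda>n. x_bar p l / real n powr ((real p - 1) * \<alpha> / 2))
          \<sim>[sequentially] (\<lambda>n. magnetization (beta_seq \<alpha> n) (K_seq p l \<alpha> n)))
     \<and> (\<forall>\<alpha>. \<alpha> = 1 / (2 * real p - 1) \<longrightarrow>
        (\<lambda>n. mean_abs_spin n (beta_seq \<alpha> n) (K_seq p l \<alpha> n))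
          \<sim>[sequentially] (\<lambda>n. z_bar p l / real n powr ((real p - 1) / (2 * (2 * real p - 1))))
        \<and> (\<lambda>n. z_bar p l / real n powr ((real p - 1) / (2 * (2 * real p - 1))))
          \<sim>[sequentially] (\<lambda>n. z_bar p l * magnetization (beta_seq \<alpha> n) (K_seq p l \<alpha> n) / x_bar p l))"
proof (intro conjI allI impI)
  have p1: "0 < 2 * real p - 1" using assms(1) by simp
  {
    fix \<alpha> :: real assume "\<alpha> > 0"
    then interpret tricritical_path p l \<alpha> using assms by unfold_locales auto
    show "(\<lambda>n. magnetization (b n) (K n)) \<sim>[sequentially]
        (\<lambda>n. x_bar p l / real n powr ((real p - 1) * \<alpha> / 2))"
      using magnetization_asymp by (simp add: scale_def)
    fix n :: nat assume "1 \<le> n"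
    have "(beta_c - b n) powr ((real p - 1) / 2) = 1 / (real n powr \<alpha>) powr ((real p - 1) / 2)"
      by (simp add: beta_seq_def powr_divide)
    also have "(real n powr \<alpha>) powr ((real p - 1) / 2) = real n powr ((real p - 1) * \<alpha> / 2)"
      by (simp add: powr_powr mult.commute)
    finally show "x_bar p l / real n powr ((real p - 1) * \<alpha> / 2)
        = x_bar p l * (beta_c - b n) powr ((real p - 1) / 2)" by simp
  next
    fix \<alpha> :: real assume range: "0 < \<alpha> \<and> \<alpha> < 1 / (2 * real p - 1)"
    then interpret tricritical_path p l \<alpha> using assms p1 by unfold_locales auto
    have "\<alpha> * (2 * real p - 1) < 1" using range pos_less_divide_eq[OF p1, THEN iffD1] by blast
    then have "(2 * real p - 1) * \<alpha> < 1" by (simp only: mult.commute)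
    then show "(\<lambda>n. mean_abs_spin n (b n) (K n)) \<sim>[sequentially]
        (\<lambda>n. x_bar p l / real n powr ((real p - 1) * \<alpha> / 2))"
      using asymp_of_scaled_limit[OF mean_abs_spin_subcritical] x_bar_pos by (simp add: scale_def)
    show "(\<lambda>n. x_bar p l / real n powr ((real p - 1) * \<alpha> / 2)) \<sim>[sequentially]
        (\<lambda>n. magnetization (b n) (K n))"
      using magnetization_asymp by (simp add: scale_def asymp_equiv_sym)
  next
    fix \<alpha> :: real assume alpha_eq: "\<alpha> = 1 / (2 * real p - 1)"
    then interpret tricritical_path p l \<alpha> using assms p1 by unfold_locales auto
    have crit: "(2 * real p - 1) * \<alpha> = 1" using alpha_eq p1 by simp
    have scale_eq: "scale n = real n powr ((real p - 1) / (2 * (2 * real p - 1)))" for n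
      unfolding scale_def by (simp add: alpha_eq)
    show "(\<lambda>n. mean_abs_spin n (b n) (K n)) \<sim>[sequentially]
        (\<lambda>n. z_bar p l / real n powr ((real p - 1) / (2 * (2 * real p - 1))))"
      using asymp_of_scaled_limit[OF mean_abs_spin_critical[OF crit]] z_bar_pos by (simp add: scale_eq)
    have "(\<lambda>n. scale n * (z_bar p l * magnetization (b n) (K n) / x_bar p l)) \<longlonglongrightarrow> z_bar p l"
      using tendsto_mult[OF tendsto_const[of "z_bar p l / x_bar p l"] magnetization_tendsto] x_bar_pos
      by (simp add: mult_ac)
    then have "(\<lambda>n. z_bar p l * magnetization (b n) (K n) / x_bar p l) \<sim>[sequentially] (\<lambda>n. z_bar p l / scale n)"
      using z_bar_pos by (intro asymp_of_scaled_limit) auto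
    then show "(\<lambda>n. z_bar p l / real n powr ((real p - 1) / (2 * (2 * real p - 1)))) \<sim>[sequentially]
        (\<lambda>n. z_bar p l * magnetization (b n) (K n) / x_bar p l)"
      by (simp add: scale_eq asymp_equiv_sym)
  }
qed

end
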